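(* Let $W\in\mathcal W^{r,0}_L$ (class defined in the context, $r\ge2$, $L>0$) and let $q\in\{0,\dots,r-1\}$. For $\xi\in M$ let $F_\xi$ be the function describing $W$ near $\xi$ and set $J^F_\xi(x,y)=\det(\partial_xF_\xi)(x,y)$. Then there exist $C>0$ and $\rho_0>0$ such that, for each $\xi\in M$, each $0<\rho<\rho_0$ and $\|(x',y')\|\le\rho$, one has $\|\det(\partial_xF_\xi)(x',\cdot)\|_{\mathcal C^q}\le C$ (norm over the $y'$ with $\|(x',y')\|\le\rho$). More precisely, $$\partial_yJ^F_\xi=J^F_\xi\cdot H^{F_\xi},\qquad J^F_\xi(x,0)=1.$$
   Context: **Phase space and cones.** $M$ is a $\mathcal C^r$ compact $d$-dimensional manifold with finite atlas $\{(V_i,\phi_i)\}_{i=1}^S$, $U_i=\phi_i(V_i)\subset\mathbb R^d=\mathbb R^{d_u}\times\mathbb R^{d_s}\ni(x,y)$, and $\mathcal C=\{C(\xi)\}_{\xi\in M}$ is a continuous field of closed cones $C(\xi)\subset T_\xi M$ (the stable cone field of an Anosov diffeomorphism $T\in\mathrm{Diff}^r(M)$) such that $D\phi_iC(\xi)=\{(x,y):\|x\|\le\|y\|\}$ for $\xi\in V_i$. **Foliations.** A $\mathcal C^r$ $d_s$-dimensional foliation $W=\{W_\alpha\}_{\alpha\in A}$ is a collection of pairwise disjoint sets with $\bigcup_\alpha W_\alpha=M$ such that each $\xi\in W_\alpha$ has a neighbourhood $B(\xi)$ for which the connected component $W(\xi)$ of $W_\alpha\cap B(\xi)$ containing $\xi$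 is a $\mathcal C^r$ $d_s$-dimensional open submanifold. $\mathcal F^r_{\mathcal C}$ is the set of those with $T_\xi W(\xi)\subset C(\xi)$ for all $\xi$. Fix $\delta_0>0$ sufficiently small, so that in particular for each $\xi$ there is a chart, fixed once and for all, $(V_i,\phi_i)$, $\xi\in V_i$, with $U_i\supset B_{\delta_0}(\phi_i(\xi))$. Let $U^0=U^0_u\times U^0_s$ with $U^0_u=B_{\delta_0/2}(0)\subset\mathbb R^{d_u}$, $U^0_s=B_{\delta_0/2}(0)\subset\mathbb R^{d_s}$. For $W\in\mathcal F^r_{\mathcal C}$, with $(x_\xi,y_\xi)=\phi_i(\xi)$, define $F_\xi:U^0\to\mathbb R^{d_u}$ by requiring that the leaf (in the chart) through $(x+x_\xi,y_\xi)$ is $\{(F_\xi(x,y)+x_\xi,\,y+y_\xi)\}_y$; thus $F_\xi(x,0)=x$. Put $\mathbb F_\xi(x,y)=(F_\xi(x,y),y)$. Define $H^{F_\xi}:U^0\to\mathbb R^{d_s}$ by $$H^{F_\xi}(x,y)=\sum_{j=1}^{d_u}\left[\partial_{x_j}\left([\partial_y(F_\xi)_j]\circ\mathbb F_\xi^{-1}\right)\right]\circ\mathbb F_\xi(x,y)=\sum_{i,j}\partial_{x_i}\partial_y(F_\xi)_j\cdot(\partial_xF_\xi)^{-1}_{ij}.$$ Let $\overline{\mathcal F}^r_{\mathcal C}=\{W\in\mathcal F^r_{\mathcal C}:\mathbb F_\xi\in\mathcal C^r(U^0,\mathbb R^d)\ \forall\xi\}$; the $\mathbb F_\xi$ are local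 coordinates, so $\partial_xF_\xi$ is invertible. $\mathcal W^{r,0}_L$ is the set of $W\in\overline{\mathcal F}^r_{\mathcal C}$ such that, with $\alpha$ a multi-index in $y$ and sups over all $\xi\in M$ and $(x,y)\in U^0$: $\sup\|\partial^\alpha_yF_\xi\|\le L^{(|\alpha|-1)^2}$ for $2\le|\alpha|\le r$; $\sup\|\partial^\alpha_yF_\xi\|\le2L^{|\alpha|^2}$ for $|\alpha|\le r-1$; $\sup\|\partial^\alpha_yH^{F_\xi}\|\le L^{(|\alpha|+1)^2}$ for $|\alpha|\le r-2$; $\sup\|\partial^\alpha_yH^{F_\xi}\|\le2L^{(|\alpha|+2)^2}$ for $|\alpha|\le r-3$. $\|g\|_{\mathcal C^q}=\sum_{k=0}^q\sup_{|\alpha|=k}\|\partial^\alpha g\|_{\mathcal C^0}$. *)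

theory Defs
  imports "HOL-Analysis.Analysis"
begin

section \<open>Partial derivatives, functions of class \<open>C\<^sup>k\<close>, and the \<open>C\<^sup>q\<close> norm\<close>

definition dpart :: "'a::real_normed_vector \<Rightarrow> ('a \<Rightarrow> 'b::real_normed_vector) \<Rightarrow> 'a \<Rightarrow> 'b" where
  "dpart b f p = vector_derivative (\<lambda>t::real. f (p + t *\<^sub>R b)) (at 0)"

text \<open>A multi-index of order \<open>k\<close> is encoded by a list of \<open>k\<close> directions, so a direction is
  repeated according to its multiplicity.  All functions differentiated below are sufficiently
  often continuously differentiable, so the order of the list is immaterial.\<close>

primrec mpart :: "'a::real_normed_vector list \<Rightarrow> ('a \<Rightarrow> 'b::real_normed_vector) \<Rightarrow> 'a \<Rightarrow> 'b" where
  "mpart [] f = f"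
| "mpart (b # bs) f = dpart b (mpart bs f)"

text \<open>Only used on open sets \<open>S\<close>.\<close>

primrec Ck_on :: "nat \<Rightarrow> ('a::euclidean_space \<Rightarrow> 'b::real_normed_vector) \<Rightarrow> 'a set \<Rightarrow> bool" where
  "Ck_on 0 f S \<longleftrightarrow> continuous_on S f"
| "Ck_on (Suc k) f S \<longleftrightarrow> (\<forall>p\<in>S. f differentiable (at p)) \<and> (\<forall>b\<in>Basis. Ck_on k (dpart b f) S)"

text \<open>The suprema are taken in \<^typ>\<open>ennreal\<close>, so that an unbounded derivative gives \<open>\<infinity>\<close>.\<close>

definition C_norm ::
  "nat \<Rightarrow> 'a::euclidean_space set \<Rightarrow> ('a \<Rightarrow> 'b::real_normed_vector) \<Rightarrow> ennreal" where
  "C_norm q S g =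
     (\<Sum>k\<le>q. SUP \<alpha>\<in>{\<alpha>. length \<alpha> = k \<and> set \<alpha> \<subseteq> Basis}. SUP p\<in>S. ennreal (norm (mpart \<alpha> g p)))"


section \<open>Manifolds, tangent vectors and maps in terms of an atlas\<close>

type_synonym ('u, 's) model = "(real ^ 'u) \<times> (real ^ 's)"

type_synonym ('m, 'u, 's) chart = "'m set \<times> ('m \<Rightarrow> ('u, 's) model)"

abbreviation cdom :: "('m, 'u, 's) chart \<Rightarrow> 'm set" where "cdom \<equiv> fst"
abbreviation cmap :: "('m, 'u, 's) chart \<Rightarrow> 'm \<Rightarrow> ('u, 's) model" where "cmap \<equiv> snd"

definition crange :: "('m, 'u, 's) chart \<Rightarrow> ('u, 's) model set" where
  "crange c = cmap c ` cdom c"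

definition cinv :: "('m, 'u, 's) chart \<Rightarrow> ('u, 's) model \<Rightarrow> 'm" where
  "cinv c = the_inv_into (cdom c) (cmap c)"

definition is_atlas :: "nat \<Rightarrow> ('m::topological_space, 'u::finite, 's::finite) chart set \<Rightarrow> bool" where
  "is_atlas r \<A> \<longleftrightarrow>
     finite \<A> \<and> (\<Union>c\<in>\<A>. cdom c) = UNIV \<and>
     (\<forall>c\<in>\<A>. open (cdom c) \<and> open (crange c) \<and>
              homeomorphism (cdom c) (crange c) (cmap c) (cinv c)) \<and>
     (\<forall>c\<in>\<A>. \<forall>d\<in>\<A>. Ck_on r (cmap d \<circ> cinv c) (cmap c ` (cdom c \<inter> cdom d)))"

text \<open>A tangent vector at \<open>\<xi>\<close> is the family of its representatives \<open>v c\<close> in the charts \<open>c\<close> around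
  \<open>\<xi>\<close>, matched by the derivatives of the coordinate changes (and \<open>0\<close> for all other charts, to make
  the representation unique).  Thus the differential of the chart \<open>c\<close> is \<open>\<lambda>v. v c\<close>.\<close>

type_synonym ('m, 'u, 's) tvec = "('m, 'u, 's) chart \<Rightarrow> ('u, 's) model"

definition tangent_space ::
  "('m, 'u::finite, 's::finite) chart set \<Rightarrow> 'm \<Rightarrow> ('m, 'u, 's) tvec set" where
  "tangent_space \<A> \<xi> =
     {v. (\<forall>c. \<not> (c \<in> \<A> \<and> \<xi> \<in> cdom c) \<longrightarrow> v c = 0) \<and>
         (\<forall>c\<in>\<A>. \<forall>d\<in>\<A>. \<xi> \<in> cdom c \<inter> cdom d \<longrightarrow>
            v d = frechet_derivative (cmap d \<circ> cinv c) (at (cmap c \<xi>)) (v c))}"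

text \<open>The tangent vector at \<open>\<xi>\<close> represented by \<open>u\<close> in the chart \<open>c\<close>.\<close>

definition tvec_of ::
  "('m, 'u::finite, 's::finite) chart set \<Rightarrow> ('m, 'u, 's) chart \<Rightarrow> 'm \<Rightarrow> ('u, 's) model
     \<Rightarrow> ('m, 'u, 's) tvec" where
  "tvec_of \<A> c \<xi> u =
     (\<lambda>d. if d \<in> \<A> \<and> \<xi> \<in> cdom d
          then frechet_derivative (cmap d \<circ> cinv c) (at (cmap c \<xi>)) u else 0)"

definition Ck_map ::
  "('m::topological_space, 'u::finite, 's::finite) chart set \<Rightarrow> nat \<Rightarrow> ('m \<Rightarrow> 'm) \<Rightarrow> bool" where
  "Ck_map \<A> r f \<longleftrightarrow> continuous_on UNIV f \<and>
     (\<forall>c\<in>\<A>. \<forall>d\<in>\<A>. Ck_on r (cmap d \<circ> f \<circ> cinv c) (cmap c ` (cdom c \<inter> f -` cdom d)))"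

definition Ck_diffeo ::
  "('m::topological_space, 'u::finite, 's::finite) chart set \<Rightarrow> nat \<Rightarrow> ('m \<Rightarrow> 'm) \<Rightarrow> bool" where
  "Ck_diffeo \<A> r f \<longleftrightarrow> bij f \<and> Ck_map \<A> r f \<and> Ck_map \<A> r (inv f)"

text \<open>By the chain rule the choice of the chart \<open>c\<close> around \<open>\<xi>\<close> is immaterial.\<close>

definition tangent_map ::
  "('m, 'u::finite, 's::finite) chart set \<Rightarrow> ('m \<Rightarrow> 'm) \<Rightarrow> 'm \<Rightarrow> ('m, 'u, 's) tvec
     \<Rightarrow> ('m, 'u, 's) tvec" where
  "tangent_map \<A> f \<xi> v =
     (let c = (SOME c. c \<in> \<A> \<and> \<xi> \<in> cdom c)
      in (\<lambda>d. if d \<in> \<A> \<and> f \<xi> \<in> cdom d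
              then frechet_derivative (cmap d \<circ> f \<circ> cinv c) (at (cmap c \<xi>)) (v c) else 0))"

definition riemannian_metric ::
  "('m::topological_space, 'u::finite, 's::finite) chart set
     \<Rightarrow> ('m \<Rightarrow> ('m, 'u, 's) tvec \<Rightarrow> ('m, 'u, 's) tvec \<Rightarrow> real) \<Rightarrow> bool" where
  "riemannian_metric \<A> g \<longleftrightarrow>
     (\<forall>c\<in>\<A>.
        (\<forall>\<xi>\<in>cdom c.
           bilinear (\<lambda>u w. g \<xi> (tvec_of \<A> c \<xi> u) (tvec_of \<A> c \<xi> w)) \<and>
           (\<forall>v\<in>tangent_space \<A> \<xi>. \<forall>w\<in>tangent_space \<A> \<xi>. g \<xi> v w = g \<xi> w v) \<and>
           (\<forall>v\<in>tangent_space \<A> \<xi>. v \<noteq> (\<lambda>_. 0) \<longrightarrow> 0 < g \<xi> v v)) \<and>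
        (\<forall>u w. continuous_on (cdom c) (\<lambda>\<xi>. g \<xi> (tvec_of \<A> c \<xi> u) (tvec_of \<A> c \<xi> w))))"


section \<open>Anosov diffeomorphisms and their stable cones\<close>

definition std_cone :: "('u::finite, 's::finite) model set" where
  "std_cone = {(x, y). norm x \<le> norm y}"

text \<open>Since the cones are the constant closed cone \<^const>\<open>std_cone\<close> in every chart, they are closed
  and depend continuously on the base point.\<close>

definition cone_field ::
  "('m, 'u::finite, 's::finite) chart set \<Rightarrow> ('m \<Rightarrow> ('m, 'u, 's) tvec set) \<Rightarrow> bool" where
  "cone_field \<A> K \<longleftrightarrow>
     (\<forall>\<xi>. K \<xi> \<subseteq> tangent_space \<A> \<xi> \<and> (\<forall>c\<in>\<A>. \<xi> \<in> cdom c \<longrightarrow> (\<lambda>v. v c) ` K \<xi> = std_cone))"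

definition cone_interior ::
  "('m, 'u::finite, 's::finite) chart set \<Rightarrow> ('m \<Rightarrow> ('m, 'u, 's) tvec set) \<Rightarrow> 'm
     \<Rightarrow> ('m, 'u, 's) tvec set" where
  "cone_interior \<A> K \<xi> =
     {v \<in> K \<xi>. \<forall>c\<in>\<A>. \<xi> \<in> cdom c \<longrightarrow> v c \<in> interior ((\<lambda>w. w c) ` K \<xi>)}"

text \<open>\<open>f\<close> is a \<open>C\<^sup>r\<close> Anosov diffeomorphism with stable cone field \<open>K\<close>, i.e. hyperbolicity is
  expressed by cones: \<open>K\<close> is strictly invariant under the differential of \<open>f\<inverse>\<close>, vectors in \<open>K\<close> are
  expanded by \<open>f\<inverse>\<close>, and vectors outside \<open>K\<close> are expanded by \<open>f\<close>.  By compactness, the choice of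
  the Riemannian metric is immaterial.\<close>

definition anosov_stable_cone ::
  "('m::topological_space, 'u::finite, 's::finite) chart set \<Rightarrow> nat \<Rightarrow> ('m \<Rightarrow> 'm)
     \<Rightarrow> ('m \<Rightarrow> ('m, 'u, 's) tvec set) \<Rightarrow> bool" where
  "anosov_stable_cone \<A> r f K \<longleftrightarrow>
     Ck_diffeo \<A> r f \<and> cone_field \<A> K \<and>
     (\<forall>\<xi>. \<forall>v\<in>K \<xi>. v \<noteq> (\<lambda>_. 0) \<longrightarrow>
        tangent_map \<A> (inv f) \<xi> v \<in> cone_interior \<A> K (inv f \<xi>)) \<and>
     (\<exists>g c\<^sub>0 \<nu> \<mu>. riemannian_metric \<A> g \<and> 0 < c\<^sub>0 \<and> 0 < \<nu> \<and> \<nu> < 1 \<and> 1 < \<mu> \<and>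
        (\<forall>n \<xi>.
           (\<forall>v\<in>K \<xi>. let w = tangent_map \<A> (inv f ^^ n) \<xi> v; \<eta> = (inv f ^^ n) \<xi>
              in sqrt (g \<eta> w w) \<ge> c\<^sub>0 * (1 / \<nu>) ^ n * sqrt (g \<xi> v v)) \<and>
           (\<forall>v\<in>tangent_space \<A> \<xi> - K \<xi>. let w = tangent_map \<A> (f ^^ n) \<xi> v; \<eta> = (f ^^ n) \<xi>
              in sqrt (g \<eta> w w) \<ge> c\<^sub>0 * \<mu> ^ n * sqrt (g \<xi> v v))))"


section \<open>Foliations adapted to the cone field\<close>

text \<open>Embedded submanifolds (without boundary) of dimension \<^term>\<open>CARD('s)\<close>, described by local
  parametrisations.\<close>

definition submanifold ::
  "('m::topological_space, 'u::finite, 's::finite) chart set \<Rightarrow> nat \<Rightarrow> 'm set \<Rightarrow> bool" where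
  "submanifold \<A> r N \<longleftrightarrow>
     (\<forall>p\<in>N. \<forall>c\<in>\<A>. p \<in> cdom c \<longrightarrow>
        (\<exists>Q P (\<psi> :: real ^ 's \<Rightarrow> ('u, 's) model) \<psi>'.
           open Q \<and> p \<in> Q \<and> Q \<subseteq> cdom c \<and> open P \<and> Ck_on r \<psi> P \<and>
           (\<forall>z\<in>P. inj (frechet_derivative \<psi> (at z))) \<and>
           homeomorphism P (cmap c ` (N \<inter> Q)) \<psi> \<psi>'))"

text \<open>The tangent vectors to \<open>N\<close> at \<open>p\<close>: velocities of curves in \<open>N\<close> through \<open>p\<close>.\<close>

definition tangent_to ::
  "('m, 'u::finite, 's::finite) chart set \<Rightarrow> 'm set \<Rightarrow> 'm \<Rightarrow> ('m, 'u, 's) tvec set" where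
  "tangent_to \<A> N p =
     {v \<in> tangent_space \<A> p.
        \<exists>\<gamma>::real \<Rightarrow> 'm. \<gamma> 0 = p \<and> (\<forall>t. \<gamma> t \<in> N) \<and>
          (\<forall>c\<in>\<A>. p \<in> cdom c \<longrightarrow> ((cmap c \<circ> \<gamma>) has_vector_derivative v c) (at 0))}"

definition leaf :: "'m set set \<Rightarrow> 'm \<Rightarrow> 'm set" where
  "leaf W p = \<Union>{A \<in> W. p \<in> A}"

text \<open>\<open>B\<close> is a neighbourhood of \<open>\<xi>\<close> in which the local leaf through \<open>\<xi>\<close> is a submanifold.\<close>

definition leaf_nbhd ::
  "('m::topological_space, 'u::finite, 's::finite) chart set \<Rightarrow> nat \<Rightarrow> 'm set set \<Rightarrow> 'm \<Rightarrow> 'm set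
     \<Rightarrow> bool" where
  "leaf_nbhd \<A> r W \<xi> B \<longleftrightarrow>
     open B \<and> \<xi> \<in> B \<and> submanifold \<A> r (connected_component_set (leaf W \<xi> \<inter> B) \<xi>)"

definition foliation ::
  "('m::topological_space, 'u::finite, 's::finite) chart set \<Rightarrow> nat \<Rightarrow> 'm set set \<Rightarrow> bool" where
  "foliation \<A> r W \<longleftrightarrow> partition_on UNIV W \<and> (\<forall>\<xi>. \<exists>B. leaf_nbhd \<A> r W \<xi> B)"

definition cone_foliations ::
  "('m::topological_space, 'u::finite, 's::finite) chart set \<Rightarrow> nat
     \<Rightarrow> ('m \<Rightarrow> ('m, 'u, 's) tvec set) \<Rightarrow> 'm set set set" where
  "cone_foliations \<A> r K =
     {W. foliation \<A> r W \<and>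
         (\<forall>\<xi> B. leaf_nbhd \<A> r W \<xi> B \<longrightarrow>
            tangent_to \<A> (connected_component_set (leaf W \<xi> \<inter> B) \<xi>) \<xi> \<subseteq> K \<xi>)}"


section \<open>The functions describing a foliation in the charts\<close>

definition U0 :: "real \<Rightarrow> ('u::finite, 's::finite) model set" where
  "U0 \<delta> = ball 0 (\<delta> / 2) \<times> ball 0 (\<delta> / 2)"

definition chart_choice ::
  "('m, 'u::finite, 's::finite) chart set \<Rightarrow> real \<Rightarrow> ('m \<Rightarrow> ('m, 'u, 's) chart) \<Rightarrow> bool" where
  "chart_choice \<A> \<delta> \<kappa> \<longleftrightarrow>
     (\<forall>\<xi>. \<kappa> \<xi> \<in> \<A> \<and> \<xi> \<in> cdom (\<kappa> \<xi>) \<and> ball (cmap (\<kappa> \<xi>) \<xi>) \<delta> \<subseteq> crange (\<kappa> \<xi>))"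

text \<open>With \<open>(x\<^sub>\<xi>, y\<^sub>\<xi>)\<close> the coordinates of \<open>\<xi>\<close>, this is the leaf, in the chart \<open>\<kappa> \<xi>\<close> and over the
  ball of radius \<open>\<delta> / 2\<close> around \<open>y\<^sub>\<xi>\<close>, through the point \<open>(x + x\<^sub>\<xi>, y\<^sub>\<xi>)\<close>.  Other pieces of the same
  global leaf which return to the chart are excluded by passing to the path component.\<close>

definition chart_leaf ::
  "real \<Rightarrow> ('m \<Rightarrow> ('m, 'u::finite, 's::finite) chart) \<Rightarrow> 'm set set \<Rightarrow> 'm \<Rightarrow> real ^ 'u
     \<Rightarrow> ('u, 's) model set" where
  "chart_leaf \<delta> \<kappa> W \<xi> x =
     (let c = \<kappa> \<xi>; p = (x, 0) + cmap c \<xi>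
      in path_component_set
           (cmap c ` (leaf W (cinv c p) \<inter> cdom c) \<inter> (UNIV \<times> ball (snd (cmap c \<xi>)) (\<delta> / 2))) p)"

definition chart_leaves_are_graphs ::
  "real \<Rightarrow> ('m \<Rightarrow> ('m, 'u::finite, 's::finite) chart) \<Rightarrow> 'm set set \<Rightarrow> 'm \<Rightarrow> bool" where
  "chart_leaves_are_graphs \<delta> \<kappa> W \<xi> \<longleftrightarrow>
     (\<forall>(x, y) \<in> U0 \<delta>. \<exists>!u. (u, y) + cmap (\<kappa> \<xi>) \<xi> \<in> chart_leaf \<delta> \<kappa> W \<xi> x)"

definition fol_fun ::
  "real \<Rightarrow> ('m \<Rightarrow> ('m, 'u::finite, 's::finite) chart) \<Rightarrow> 'm set set \<Rightarrow> 'm \<Rightarrow> ('u, 's) model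
     \<Rightarrow> real ^ 'u" where
  "fol_fun \<delta> \<kappa> W \<xi> = (\<lambda>(x, y). THE u. (u, y) + cmap (\<kappa> \<xi>) \<xi> \<in> chart_leaf \<delta> \<kappa> W \<xi> x)"

definition fol_map ::
  "real \<Rightarrow> ('m \<Rightarrow> ('m, 'u::finite, 's::finite) chart) \<Rightarrow> 'm set set \<Rightarrow> 'm \<Rightarrow> ('u, 's) model
     \<Rightarrow> ('u, 's) model" where
  "fol_map \<delta> \<kappa> W \<xi> z = (fol_fun \<delta> \<kappa> W \<xi> z, snd z)"

text \<open>The condition \<^const>\<open>chart_leaves_are_graphs\<close> says that the functions describing \<open>W\<close> exist
  on all of \<^const>\<open>U0\<close>, which is part of what it means that \<open>\<delta>\<close> is small.\<close>

definition regular_cone_foliations ::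
  "('m::topological_space, 'u::finite, 's::finite) chart set \<Rightarrow> nat
     \<Rightarrow> ('m \<Rightarrow> ('m, 'u, 's) tvec set) \<Rightarrow> real \<Rightarrow> ('m \<Rightarrow> ('m, 'u, 's) chart)
     \<Rightarrow> 'm set set set" where
  "regular_cone_foliations \<A> r K \<delta> \<kappa> =
     {W \<in> cone_foliations \<A> r K.
        \<forall>\<xi>. chart_leaves_are_graphs \<delta> \<kappa> W \<xi> \<and> Ck_on r (fol_map \<delta> \<kappa> W \<xi>) (U0 \<delta>)}"

definition dirx :: "'u::finite \<Rightarrow> ('u, 's::finite) model" where
  "dirx i = (axis i 1, 0)"

definition diry :: "'s::finite \<Rightarrow> ('u::finite, 's) model" where
  "diry k = (0, axis k 1)"

definition fol_H ::
  "real \<Rightarrow> ('m \<Rightarrow> ('m, 'u::finite, 's::finite) chart) \<Rightarrow> 'm set set \<Rightarrow> 'm \<Rightarrow> ('u, 's) model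
     \<Rightarrow> real ^ 's" where
  "fol_H \<delta> \<kappa> W \<xi> z =
     (\<chi> k. \<Sum>j\<in>UNIV.
        dpart (dirx j)
          (dpart (diry k) (\<lambda>w. fol_fun \<delta> \<kappa> W \<xi> w $ j) \<circ> the_inv_into (U0 \<delta>) (fol_map \<delta> \<kappa> W \<xi>))
          (fol_map \<delta> \<kappa> W \<xi> z))"

definition fol_J ::
  "real \<Rightarrow> ('m \<Rightarrow> ('m, 'u::finite, 's::finite) chart) \<Rightarrow> 'm set set \<Rightarrow> 'm \<Rightarrow> ('u, 's) model
     \<Rightarrow> real" where
  "fol_J \<delta> \<kappa> W \<xi> z = det (\<chi> j i. dpart (dirx i) (\<lambda>w. fol_fun \<delta> \<kappa> W \<xi> w $ j) z)"

text \<open>The class \<open>\<W>\<close> of foliations with quantitative bounds; \<open>\<alpha>\<close> is a multi-index in \<open>y\<close>.\<close>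

definition W_class ::
  "('m::topological_space, 'u::finite, 's::finite) chart set \<Rightarrow> nat
     \<Rightarrow> ('m \<Rightarrow> ('m, 'u, 's) tvec set) \<Rightarrow> real \<Rightarrow> ('m \<Rightarrow> ('m, 'u, 's) chart)
     \<Rightarrow> real \<Rightarrow> 'm set set set" where
  "W_class \<A> r K \<delta> \<kappa> L =
     {W \<in> regular_cone_foliations \<A> r K \<delta> \<kappa>.
        \<forall>\<xi>. \<forall>z\<in>U0 \<delta>. \<forall>\<alpha> :: 's list.
          (let n = length \<alpha>;
               DF = norm (mpart (map diry \<alpha>) (fol_fun \<delta> \<kappa> W \<xi>) z);
               DH = norm (mpart (map diry \<alpha>) (fol_H \<delta> \<kappa> W \<xi>) z)
           in (2 \<le> n \<and> n \<le> r \<longrightarrow> DF \<le> L ^ ((n - 1)\<^sup>2)) \<and>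
              (n + 1 \<le> r \<longrightarrow> DF \<le> 2 * L ^ (n\<^sup>2)) \<and>
              (n + 2 \<le> r \<longrightarrow> DH \<le> L ^ ((n + 1)\<^sup>2)) \<and>
              (n + 3 \<le> r \<longrightarrow> DH \<le> 2 * L ^ ((n + 2)\<^sup>2)))}"

end

theory Submission
  imports Defs
begin

text \<open>Write \<open>A = \<partial>\<^sub>xF\<close> and \<open>J = det A\<close>.  The chart leaves being graphs over disjoint leaves, the map
  \<open>(x, y) \<mapsto> (F(x, y), y)\<close> is injective, and wherever \<open>J \<noteq> 0\<close> its inverse is differentiable, so that
  \<open>H\<^sub>k\<close> is the trace of \<open>(\<partial>\<^sub>y\<^sub>kA)A\<inverse>\<close> and Jacobi's formula gives \<open>\<partial>\<^sub>yJ = J H\<close>.  In fact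
  \<open>J\<close> has no zeros: \<open>J(x, 0) = 1\<close>, and since \<open>\<bar>H\<bar> \<le> L\<close>, Gronwall's inequality along
  \<open>t \<mapsto> (x, ty)\<close> keeps \<open>J\<close> away from \<open>0\<close> and bounded.  Hence \<open>H = \<partial>\<^sub>yJ / J\<close> is of class
  \<open>C\<^sup>r\<^sup>-\<^sup>2\<close>, and the bounds on the derivatives of \<open>H\<close> yield those of \<open>J\<close> by Leibniz' rule.\<close>

section \<open>Calculus of functions of class \<open>C\<^sup>k\<close>\<close>

lemma dpart_eq_derivative:
  assumes "(f has_derivative f') (at p)"
  shows "dpart b f p = f' b"
proof -
  have "((\<lambda>t::real. p + t *\<^sub>R b) has_derivative (\<lambda>t. t *\<^sub>R b)) (at 0)"
    by (auto intro!: derivative_eq_intros)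
  then have "((\<lambda>t. f (p + t *\<^sub>R b)) has_derivative (\<lambda>t. f' (t *\<^sub>R b))) (at 0)"
    by (rule has_derivative_compose) (use assms in simp)
  then have "((\<lambda>t. f (p + t *\<^sub>R b)) has_vector_derivative f' b) (at 0)"
    by (simp add: has_vector_derivative_def
        linear_simps[OF has_derivative_bounded_linear[OF assms]])
  then show ?thesis
    unfolding dpart_def by (rule vector_derivative_at)
qed

lemma has_derivative_dpart:
  assumes "f differentiable (at p)"
  shows "(f has_derivative (\<lambda>v. dpart v f p)) (at p)"
proof -
  obtain f' where f': "(f has_derivative f') (at p)"
    using assms by (auto simp: differentiable_def)
  then have "(\<lambda>v. dpart v f p) = f'"
    by (auto simp: dpart_eq_derivative)
  with f' show ?thesis by simp
qed

lemma has_real_derivative_dpart: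
  fixes f :: "'a::real_normed_vector \<Rightarrow> real"
  assumes "f differentiable (at (p + t *\<^sub>R b))"
  shows "((\<lambda>t. f (p + t *\<^sub>R b)) has_real_derivative dpart b f (p + t *\<^sub>R b)) (at t)"
proof -
  have "((\<lambda>t::real. p + t *\<^sub>R b) has_derivative (\<lambda>t. t *\<^sub>R b)) (at t)"
    by (auto intro!: derivative_eq_intros)
  then have "((\<lambda>t. f (p + t *\<^sub>R b)) has_derivative (\<lambda>s. dpart (s *\<^sub>R b) f (p + t *\<^sub>R b))) (at t)"
    by (rule has_derivative_compose) (use has_derivative_dpart[OF assms] in simp)
  then show ?thesis
    by (simp add: has_field_derivative_def mult.commute mult_commute_abs
        linear_simps[OF has_derivative_bounded_linear[OF has_derivative_dpart[OF assms]]])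
qed

lemma dpart_cong_open:
  assumes "open S" "p \<in> S" "\<And>x. x \<in> S \<Longrightarrow> f x = g x"
  shows "dpart b f p = dpart b g p"
proof -
  have "\<forall>\<^sub>F t in nhds (0::real). p + t *\<^sub>R b \<in> S"
  proof -
    have "isCont (\<lambda>t::real. p + t *\<^sub>R b) 0" by (intro continuous_intros)
    then have "((\<lambda>t::real. p + t *\<^sub>R b) \<longlongrightarrow> p) (nhds 0)"
      by (simp add: isCont_def tendsto_nhds_iff)
    then show ?thesis using assms(1,2) by (rule topological_tendstoD)
  qed
  then show ?thesis
    unfolding dpart_def
    by (intro vector_derivative_cong_eq) (auto elim: eventually_mono simp: assms(3))
qed

lemma differentiable_cong_open:
  assumes "open S" "p \<in> S" "\<And>x. x \<in> S \<Longrightarrow> f x = g x" "f differentiable (at p)"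
  shows "g differentiable (at p)"
  using assms by (metis differentiable_def has_derivative_transform_within_open)

text \<open>\<open>mpart\<close> applies the head of the list last, while the recursion of
  \<open>Ck_on\<close> differentiates \<open>f\<close> first. Peeling off the last entry reconciles
  the two.\<close>

lemma mpart_snoc: "mpart (bs @ [b]) f = mpart bs (dpart b f)"
  by (induction bs) auto

lemma mpart_cong_open:
  assumes "open S" "p \<in> S" "\<And>x. x \<in> S \<Longrightarrow> f x = g x"
  shows "mpart bs f p = mpart bs g p"
  using assms(2)
proof (induction bs arbitrary: p)
  case Nil
  then show ?case by (simp add: assms)
next
  case (Cons b bs)
  then show ?case using dpart_cong_open[OF assms(1) Cons.prems, of "mpart bs f" "mpart bs g"] by simp
qed

text \<open>The differentiation rules below hold only at points of \<open>S\<close>. Since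
  \<open>S\<close> is open, derivatives there are blind to values outside, so these rules may be
  used as rewriting of functions on \<open>S\<close>.\<close>

lemma Ck_on_cong_open:
  assumes "open S" "\<And>x. x \<in> S \<Longrightarrow> f x = g x" "Ck_on k f S"
  shows "Ck_on k g S"
  using assms(2,3)
proof (induction k arbitrary: f g)
  case 0
  then show ?case by (simp cong: continuous_on_cong)
next
  case (Suc k)
  have "Ck_on k (dpart b g) S" if "b \<in> Basis" for b
    using Suc.IH[of "dpart b f" "dpart b g"] Suc.prems that
      dpart_cong_open[OF assms(1), of _ f g b] by auto
  moreover have "g differentiable (at p)" if "p \<in> S" for p
    using differentiable_cong_open[OF assms(1) that Suc.prems(1)] Suc.prems that by auto
  ultimately show ?case by simp
qed

lemma Ck_on_pred: "Ck_on (Suc k) f S \<Longrightarrow> Ck_on k f S"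
proof (induction k arbitrary: f)
  case 0
  then show ?case
    by (auto intro!: continuous_at_imp_continuous_on differentiable_imp_continuous_within)
next
  case (Suc k)
  then show ?case by (simp del: Ck_on.simps add: Ck_on.simps(2)[of "Suc k"] Ck_on.simps(2)[of k])
qed

lemma Ck_on_mono:
  assumes "Ck_on k f S" "m \<le> k"
  shows "Ck_on m f S"
  using assms(2,1) by (induction rule: inc_induct) (auto dest: Ck_on_pred simp del: Ck_on.simps)

lemma Ck_on_dpart: "Ck_on (Suc k) f S \<Longrightarrow> b \<in> Basis \<Longrightarrow> Ck_on k (dpart b f) S"
  by simp

lemma Ck_on_imp_differentiable: "Ck_on (Suc k) f S \<Longrightarrow> p \<in> S \<Longrightarrow> f differentiable (at p)"
  by simp

section \<open>Closure of the classes C^k under algebraic operations\<close>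

lemma dpart_const: "dpart b (\<lambda>_. c) = (\<lambda>_. 0)"
  by (rule ext) (simp add: dpart_eq_derivative[OF has_derivative_const])

lemma Ck_on_const: "Ck_on k (\<lambda>_. c) S"
  by (induction k arbitrary: c) (auto simp: dpart_const)

lemma dpart_add:
  assumes "f differentiable (at p)" "g differentiable (at p)"
  shows "dpart b (\<lambda>p. f p + g p) p = dpart b f p + dpart b g p"
  by (rule dpart_eq_derivative)
     (intro has_derivative_add assms[THEN has_derivative_dpart])

lemma dpart_scaleR:
  fixes f :: "'a::real_normed_vector \<Rightarrow> real"
  assumes "f differentiable (at p)" "g differentiable (at p)"
  shows "dpart b (\<lambda>p. f p *\<^sub>R g p) p = f p *\<^sub>R dpart b g p + dpart b f p *\<^sub>R g p"
  by (rule dpart_eq_derivative)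
     (intro has_derivative_scaleR assms[THEN has_derivative_dpart])

lemma dpart_bounded_linear:
  assumes "bounded_linear l" "f differentiable (at p)"
  shows "dpart b (\<lambda>p. l (f p)) p = l (dpart b f p)"
  by (rule dpart_eq_derivative)
     (intro bounded_linear.has_derivative[OF assms(1)] has_derivative_dpart assms(2))

lemma Ck_on_add:
  assumes "open S" "Ck_on k f S" "Ck_on k g S"
  shows "Ck_on k (\<lambda>p. f p + g p) S"
  using assms(2,3)
proof (induction k arbitrary: f g)
  case 0
  then show ?case by (simp add: continuous_on_add)
next
  case (Suc k)
  have "Ck_on k (dpart b (\<lambda>p. f p + g p)) S" if "b \<in> Basis" for b
    by (rule Ck_on_cong_open[OF assms(1) _ Suc.IH[of "dpart b f" "dpart b g"]])
       (use Suc.prems that in \<open>auto simp: dpart_add\<close>)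
  with Suc.prems show ?case by auto
qed

text \<open>Leibniz' rule leaves one factor undifferentiated in each summand;
  \<open>Ck_on_pred\<close> lowers its class to the one required by the induction
  hypothesis.\<close>

lemma Ck_on_scaleR:
  fixes f :: "'a::euclidean_space \<Rightarrow> real"
  assumes "open S" "Ck_on k f S" "Ck_on k g S"
  shows "Ck_on k (\<lambda>p. f p *\<^sub>R g p) S"
  using assms(2,3)
proof (induction k arbitrary: f g)
  case 0
  then show ?case by (simp add: continuous_on_scaleR)
next
  case (Suc k)
  have "Ck_on k (dpart b (\<lambda>p. f p *\<^sub>R g p)) S" if "b \<in> Basis" for b
    by (rule Ck_on_cong_open[OF assms(1) _
          Ck_on_add[OF assms(1) Suc.IH[of f "dpart b g"] Suc.IH[of "dpart b f" g]]])
       (use Suc.prems that Ck_on_pred[OF Suc.prems(1)] Ck_on_pred[OF Suc.prems(2)]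
         in \<open>auto simp: dpart_scaleR\<close>)
  with Suc.prems show ?case by (auto intro: differentiable_scaleR)
qed

lemma Ck_on_bounded_linear:
  assumes "open S" "bounded_linear l" "Ck_on k f S"
  shows "Ck_on k (\<lambda>p. l (f p)) S"
  using assms(3)
proof (induction k arbitrary: f)
  case 0
  then show ?case by (simp add: bounded_linear.continuous_on[OF assms(2)])
next
  case (Suc k)
  have "Ck_on k (dpart b (\<lambda>p. l (f p))) S" if "b \<in> Basis" for b
    by (rule Ck_on_cong_open[OF assms(1) _ Suc.IH[of "dpart b f"]])
       (use Suc.prems that in \<open>auto simp: dpart_bounded_linear[OF assms(2)]\<close>)
  moreover have "(\<lambda>p. l (f p)) differentiable (at p)" if "p \<in> S" for p
    using Suc.prems that bounded_linear.has_derivative[OF assms(2)] unfolding differentiable_def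
    by (metis Ck_on_imp_differentiable differentiable_def)
  ultimately show ?case by simp
qed

lemma Ck_on_sum:
  assumes "open S" "\<And>i. i \<in> I \<Longrightarrow> Ck_on k (f i) S"
  shows "Ck_on k (\<lambda>p. \<Sum>i\<in>I. f i p) S"
  using assms(2)
  by (induction I rule: infinite_finite_induct) (auto intro: Ck_on_const Ck_on_add[OF assms(1)])

lemma Ck_on_mult:
  fixes f g :: "'a::euclidean_space \<Rightarrow> real"
  assumes "open S" "Ck_on k f S" "Ck_on k g S"
  shows "Ck_on k (\<lambda>p. f p * g p) S"
  using Ck_on_scaleR[OF assms] by simp

lemma Ck_on_prod:
  fixes f :: "'i \<Rightarrow> 'a::euclidean_space \<Rightarrow> real"
  assumes "open S" "\<And>i. i \<in> I \<Longrightarrow> Ck_on k (f i) S"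
  shows "Ck_on k (\<lambda>p. \<Prod>i\<in>I. f i p) S"
  using assms(2)
  by (induction I rule: infinite_finite_induct) (auto intro: Ck_on_const Ck_on_mult[OF assms(1)])

lemma Ck_on_inverse:
  fixes f :: "'a::euclidean_space \<Rightarrow> real"
  assumes "open S" "Ck_on k f S" "\<And>p. p \<in> S \<Longrightarrow> f p \<noteq> 0"
  shows "Ck_on k (\<lambda>p. inverse (f p)) S"
  using assms(2)
proof (induction k)
  case 0
  then show ?case by (simp add: assms(3) continuous_on_inverse)
next
  case (Suc k)
  have inv: "Ck_on k (\<lambda>p. inverse (f p)) S"
    by (rule Suc.IH[OF Ck_on_pred[OF Suc.prems]])
  \<comment> \<open>The derivative of \<open>1/f\<close> contains \<open>1/f\<close> again, which is
    of class C^k by \<open>inv\<close>. The factor \<open>- 1\<close> is kept explicit so that the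
    expression is literally a product covered by \<open>Ck_on_mult\<close>.\<close>
  have der: "((\<lambda>p. inverse (f p)) has_derivative
      (\<lambda>v. (- 1) * (inverse (f p) * dpart v f p * inverse (f p)))) (at p)" if "p \<in> S" for p
    using Suc.prems that assms(3)
    by (auto intro!: derivative_eq_intros has_derivative_dpart)
  have "Ck_on k (dpart b (\<lambda>p. inverse (f p))) S" if "b \<in> Basis" for b
    by (rule Ck_on_cong_open[OF assms(1) _ Ck_on_mult[OF assms(1) Ck_on_const
          Ck_on_mult[OF assms(1) Ck_on_mult[OF assms(1) inv Ck_on_dpart[OF Suc.prems that]] inv]]])
       (simp only: dpart_eq_derivative[OF der])
  moreover have "(\<lambda>p. inverse (f p)) differentiable (at p)" if "p \<in> S" for p
    using der[OF that] by (auto simp: differentiable_def)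
  ultimately show ?case by simp
qed

lemma Ck_on_det:
  fixes A :: "'a::euclidean_space \<Rightarrow> real ^ 'n ^ 'n"
  assumes "open S" "\<And>i j. Ck_on k (\<lambda>p. A p $ i $ j) S"
  shows "Ck_on k (\<lambda>p. det (A p)) S"
  unfolding det_def
  by (intro Ck_on_sum Ck_on_mult Ck_on_prod Ck_on_const assms)

section \<open>Restriction to slices with fixed x\<close>

lemma dpart_slice: "dpart b (\<lambda>y. f (x, y)) = (\<lambda>y. dpart (0, b) f (x, y))"
  by (rule ext) (simp add: dpart_def)

text \<open>No regularity of \<open>f\<close> enters: \<open>dpart\<close> only looks along a line,
  and lines in the slice are lines in a direction \<open>(0, b)\<close>.\<close>

lemma mpart_slice: "mpart bs (\<lambda>y. f (x, y)) = (\<lambda>y. mpart (map (Pair 0) bs) f (x, y))"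
  by (induction bs) (simp_all add: dpart_slice)

lemma differentiable_slice:
  assumes "f differentiable (at (x, y))"
  shows "(\<lambda>y. f (x, y)) differentiable (at y)"
proof -
  have "((\<lambda>y. (x, y)) has_derivative (\<lambda>v. (0, v))) (at y)"
    by (auto intro!: derivative_eq_intros)
  from has_derivative_compose[OF this, of f] assms show ?thesis
    by (auto simp: differentiable_def)
qed

lemma Ck_on_slice:
  fixes f :: "'a::euclidean_space \<times> 'b::euclidean_space \<Rightarrow> 'c::real_normed_vector"
  assumes "Ck_on k f (X \<times> Y)" "x \<in> X"
  shows "Ck_on k (\<lambda>y. f (x, y)) Y"
  using assms(1)
proof (induction k arbitrary: f)
  case 0
  have "continuous_on Y (\<lambda>y. (x, y))" by (intro continuous_intros)
  then show ?case
    using 0 assms(2) by (auto intro: continuous_on_compose2)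
next
  case (Suc k)
  have "Ck_on k (\<lambda>y. dpart (0, b) f (x, y)) Y" if "b \<in> Basis" for b
    by (rule Suc.IH) (use Suc.prems that in \<open>auto simp: Basis_prod_def\<close>)
  moreover have "(\<lambda>y. f (x, y)) differentiable (at y)" if "y \<in> Y" for y
    using Suc.prems assms(2) that by (intro differentiable_slice) auto
  ultimately show ?case by (simp add: dpart_slice)
qed

text \<open>Symmetry of second derivatives. The second difference of \<open>f\<close> over a square
  with sides along \<open>a\<close> and \<open>b\<close> is evaluated by the mean value theorem in
  both orders; by continuity at \<open>p\<close>, unequal mixed derivatives would be incompatible on
  a small square.\<close>

lemma dpart_commute:
  fixes f :: "'a::euclidean_space \<Rightarrow> real"
  assumes S: "open S" and f: "Ck_on 2 f S" and a: "a \<in> Basis" and b: "b \<in> Basis" and p: "p \<in> S"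
  shows "dpart a (dpart b f) p = dpart b (dpart a f) p"
proof (rule ccontr)
  define X Y where "X = dpart b (dpart a f)" and "Y = dpart a (dpart b f)"
  assume "dpart a (dpart b f) p \<noteq> dpart b (dpart a f) p"
  then have ne: "dist (X p) (Y p) / 2 > 0" by (simp add: X_def Y_def)
  have f1: "Ck_on 1 (dpart c f) S" if "c \<in> Basis" for c
    using f that by (simp add: numeral_2_eq_2)
  have diff: "f differentiable (at q)" if "q \<in> S" for q
    using f that by (simp add: numeral_2_eq_2)
  have diff1: "dpart c f differentiable (at q)" if "q \<in> S" "c \<in> Basis" for q c
    using f1[OF that(2)] that by simp
  have "continuous_on S X" "continuous_on S Y"
    using f a b by (auto simp: numeral_2_eq_2 X_def Y_def)
  then have "isCont X p" "isCont Y p"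
    using S p by (auto simp: continuous_on_eq_continuous_at)
  then obtain d1 d2 where d: "d1 > 0" "\<And>q. dist q p < d1 \<Longrightarrow> dist (X q) (X p) < dist (X p) (Y p) / 2"
    "d2 > 0" "\<And>q. dist q p < d2 \<Longrightarrow> dist (Y q) (Y p) < dist (X p) (Y p) / 2"
    using ne unfolding continuous_at_eps_delta by metis
  obtain e where e: "e > 0" "\<And>q. dist q p < e \<Longrightarrow> q \<in> S"
    using S p by (metis dist_commute mem_ball open_contains_ball_eq subsetD)
  \<comment> \<open>Points of the square lie within \<open>2 * h\<close> of \<open>p\<close>, so a
    third of the smallest radius keeps it inside \<open>S\<close> and inside both continuity
    neighbourhoods.\<close>
  define h where "h = min e (min d1 d2) / 3"
  have h: "h > 0" "2 * h < e" "2 * h < d1" "2 * h < d2"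
    using e d by (auto simp: h_def)
  define g where "g s t = p + s *\<^sub>R a + t *\<^sub>R b" for s t :: real
  have near: "dist (g s t) p \<le> 2 * h" if "0 \<le> s" "s \<le> h" "0 \<le> t" "t \<le> h" for s t
  proof -
    have "dist (g s t) p = norm (s *\<^sub>R a + t *\<^sub>R b)" by (simp add: g_def dist_norm algebra_simps)
    also have "\<dots> \<le> s + t"
      using that a b norm_triangle_ineq[of "s *\<^sub>R a" "t *\<^sub>R b"] by simp
    finally show ?thesis using that by simp
  qed
  then have inS: "g s t \<in> S" if "0 \<le> s" "s \<le> h" "0 \<le> t" "t \<le> h" for s t
    using that e h by (meson le_less_trans)
  have ds: "((\<lambda>s. k (g s t)) has_real_derivative dpart a k (g s t)) (at s)"
    if "k differentiable (at (g s t))" for k s t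
    using has_real_derivative_dpart[of k "p + t *\<^sub>R b" s a] that
    by (simp add: g_def algebra_simps)
  have dt: "((\<lambda>t. k (g s t)) has_real_derivative dpart b k (g s t)) (at t)"
    if "k differentiable (at (g s t))" for k s t
    using has_real_derivative_dpart[of k "p + s *\<^sub>R a" t b] that
    by (simp add: g_def algebra_simps)
  \<comment> \<open>Increments first along \<open>a\<close>, then along \<open>b\<close>, turn the
    second difference into \<open>h * h\<close> times a value of \<open>X\<close>; the opposite
    order below gives a value of \<open>Y\<close>.\<close>
  have "\<exists>z>0. z < h \<and> (f (g h h) - f (g h 0)) - (f (g 0 h) - f (g 0 0)) =
      (h - 0) * (dpart a f (g z h) - dpart a f (g z 0))"
    using h by (intro MVT2[where f = "\<lambda>s. f (g s h) - f (g s 0)"] DERIV_diff ds diff inS) auto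
  then obtain s1 where s1: "0 < s1" "s1 < h"
    "(f (g h h) - f (g h 0)) - (f (g 0 h) - f (g 0 0)) = h * (dpart a f (g s1 h) - dpart a f (g s1 0))"
    by auto
  have "\<exists>z>0. z < h \<and> dpart a f (g s1 h) - dpart a f (g s1 0) = (h - 0) * X (g s1 z)"
    using h s1 unfolding X_def
    by (intro MVT2[where f = "\<lambda>t. dpart a f (g s1 t)"] dt diff1 inS a) auto
  then obtain t1 where t1: "0 < t1" "t1 < h" "dpart a f (g s1 h) - dpart a f (g s1 0) = h * X (g s1 t1)"
    by auto
  have "\<exists>z>0. z < h \<and> (f (g h h) - f (g 0 h)) - (f (g h 0) - f (g 0 0)) =
      (h - 0) * (dpart b f (g h z) - dpart b f (g 0 z))"
    using h by (intro MVT2[where f = "\<lambda>t. f (g h t) - f (g 0 t)"] DERIV_diff dt diff inS) auto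
  then obtain t2 where t2: "0 < t2" "t2 < h"
    "(f (g h h) - f (g 0 h)) - (f (g h 0) - f (g 0 0)) = h * (dpart b f (g h t2) - dpart b f (g 0 t2))"
    by auto
  have "\<exists>z>0. z < h \<and> dpart b f (g h t2) - dpart b f (g 0 t2) = (h - 0) * Y (g z t2)"
    using h t2 unfolding Y_def
    by (intro MVT2[where f = "\<lambda>s. dpart b f (g s t2)"] ds diff1 inS b) auto
  then obtain s2 where s2: "0 < s2" "s2 < h" "dpart b f (g h t2) - dpart b f (g 0 t2) = h * Y (g s2 t2)"
    by auto
  have "h * (h * X (g s1 t1)) = h * (h * Y (g s2 t2))"
    using s1(3) t2(3) unfolding t1(3) s2(3) by linarith
  then have "X (g s1 t1) = Y (g s2 t2)" using h by simp
  moreover have "dist (X (g s1 t1)) (X p) < dist (X p) (Y p) / 2"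
    using near[of s1 t1] s1 t1 h by (intro d) auto
  moreover have "dist (Y (g s2 t2)) (Y p) < dist (X p) (Y p) / 2"
    using near[of s2 t2] s2 t2 h by (intro d) auto
  ultimately show False
    using dist_triangle[of "X p" "Y p" "X (g s1 t1)"] by (simp add: dist_commute)
qed


section \<open>Uniform bounds on derivatives\<close>

text \<open>One real constant for all orders up to \<open>k\<close> is easier to carry through
  inductions than the sum of suprema in \<open>C_norm\<close>; \<open>C_norm_le\<close> converts it
  back.\<close>

definition mpart_bound ::
  "nat \<Rightarrow> real \<Rightarrow> ('a::euclidean_space \<Rightarrow> 'b::real_normed_vector) \<Rightarrow> 'a set \<Rightarrow> bool" where
  "mpart_bound k M f S \<longleftrightarrow>
     (\<forall>\<alpha>. length \<alpha> \<le> k \<and> set \<alpha> \<subseteq> Basis \<longrightarrow> (\<forall>p\<in>S. norm (mpart \<alpha> f p) \<le> M))"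

lemma mpart_bound_0: "mpart_bound 0 M f S \<longleftrightarrow> (\<forall>p\<in>S. norm (f p) \<le> M)"
  by (auto simp: mpart_bound_def)

text \<open>The innermost derivative is split off, hence the case analysis at the end of the list;
  this matches the recursion of \<open>Ck_on\<close>, so both can be carried in one
  induction.\<close>

lemma mpart_bound_Suc:
  "mpart_bound (Suc k) M f S \<longleftrightarrow>
     (\<forall>p\<in>S. norm (f p) \<le> M) \<and> (\<forall>b\<in>Basis. mpart_bound k M (dpart b f) S)" (is "?l \<longleftrightarrow> ?r")
proof
  assume l: ?l
  have "norm (f p) \<le> M" if "p \<in> S" for p
    using l[unfolded mpart_bound_def, rule_format, of "[]" p] that by simp
  moreover have "norm (mpart \<alpha> (dpart b f) p) \<le> M"
    if "p \<in> S" "b \<in> Basis" "length \<alpha> \<le> k" "set \<alpha> \<subseteq> Basis" for p b \<alpha>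
    using l[unfolded mpart_bound_def, rule_format, of "\<alpha> @ [b]" p] that by (simp add: mpart_snoc)
  ultimately show ?r by (simp add: mpart_bound_def)
next
  assume r: ?r
  have "norm (mpart \<alpha> f p) \<le> M" if "length \<alpha> \<le> Suc k" "set \<alpha> \<subseteq> Basis" "p \<in> S" for \<alpha> p
  proof (cases \<alpha> rule: rev_cases)
    case Nil
    then show ?thesis using r that by simp
  next
    case (snoc \<beta> b)
    then show ?thesis using r that by (simp add: mpart_snoc mpart_bound_def)
  qed
  then show ?l by (simp add: mpart_bound_def)
qed

lemma mpart_bound_mono: "mpart_bound k M f S \<Longrightarrow> m \<le> k \<Longrightarrow> M \<le> N \<Longrightarrow> mpart_bound m N f S"
  unfolding mpart_bound_def by (meson le_trans order_trans)

lemma mpart_bound_cong_open: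
  assumes "open S" "\<And>x. x \<in> S \<Longrightarrow> f x = g x" "mpart_bound k M f S"
  shows "mpart_bound k M g S"
  using assms(3) mpart_cong_open[OF assms(1) _ assms(2)] by (simp add: mpart_bound_def)

lemma mpart_bound_add:
  assumes "open S" "Ck_on k f S" "Ck_on k g S" "mpart_bound k M f S" "mpart_bound k N g S"
  shows "mpart_bound k (M + N) (\<lambda>p. f p + g p) S"
  using assms(2-)
proof (induction k arbitrary: f g)
  case 0
  then show ?case by (auto simp: mpart_bound_0 intro: norm_triangle_mono)
next
  case (Suc k)
  have "mpart_bound k (M + N) (dpart b (\<lambda>p. f p + g p)) S" if "b \<in> Basis" for b
    by (rule mpart_bound_cong_open[OF assms(1) _ Suc.IH[of "dpart b f" "dpart b g"]])
       (use Suc.prems that in \<open>auto simp: dpart_add mpart_bound_Suc\<close>)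
  with Suc.prems show ?case
    by (auto simp: mpart_bound_Suc intro: norm_triangle_mono)
qed

text \<open>Each differentiation replaces a product by a sum of two products, so the constant
  doubles with every order.\<close>

lemma mpart_bound_mult:
  fixes f g :: "'a::euclidean_space \<Rightarrow> real"
  assumes "open S" "Ck_on k f S" "Ck_on k g S" "mpart_bound k M f S" "mpart_bound k N g S"
    and "0 \<le> M" "0 \<le> N"
  shows "mpart_bound k (2 ^ k * (M * N)) (\<lambda>p. f p * g p) S"
  using assms(2-5)
proof (induction k arbitrary: f g)
  case 0
  then show ?case using assms(6,7) by (auto simp: mpart_bound_0 abs_mult intro: mult_mono)
next
  case (Suc k)
  note C = Ck_on_pred[OF Suc.prems(1)] Ck_on_pred[OF Suc.prems(2)]
  note D = Ck_on_dpart[OF Suc.prems(1)] Ck_on_dpart[OF Suc.prems(2)]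
  note B = mpart_bound_mono[OF Suc.prems(3) _ order_refl, of k]
    mpart_bound_mono[OF Suc.prems(4) _ order_refl, of k]
  have "mpart_bound k (2 ^ Suc k * (M * N)) (dpart b (\<lambda>p. f p * g p)) S" if b: "b \<in> Basis" for b
  proof (rule mpart_bound_cong_open[OF assms(1)])
    show "mpart_bound k (2 ^ Suc k * (M * N)) (\<lambda>p. f p * dpart b g p + dpart b f p * g p) S"
      using mpart_bound_add[OF assms(1) Ck_on_mult[OF assms(1) C(1) D(2)[OF b]]
          Ck_on_mult[OF assms(1) D(1)[OF b] C(2)] Suc.IH[OF C(1) D(2)[OF b]]
          Suc.IH[OF D(1)[OF b] C(2)]] Suc.prems(3,4) B b
      by (simp add: mpart_bound_Suc mult_ac)
    show "f p * dpart b g p + dpart b f p * g p = dpart b (\<lambda>p. f p * g p) p" if "p \<in> S" for p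
      using dpart_scaleR[of f p g b] Suc.prems(1,2) that by simp
  qed
  moreover have "norm (f p * g p) \<le> 2 ^ Suc k * (M * N)" if "p \<in> S" for p
  proof -
    have "\<bar>f p\<bar> \<le> M" "\<bar>g p\<bar> \<le> N" using Suc.prems that by (auto simp: mpart_bound_Suc)
    then have "norm (f p * g p) \<le> 1 * (M * N)"
      using assms(6,7) by (simp add: abs_mult mult_mono)
    also have "\<dots> \<le> 2 ^ Suc k * (M * N)"
      using assms(6,7) by (intro mult_right_mono one_le_power mult_nonneg_nonneg) auto
    finally show ?thesis .
  qed
  ultimately show ?case by (auto simp: mpart_bound_Suc simp del: power_Suc)
qed

text \<open>Pairing with \<open>c\<close> commutes with differentiation and does not increase norms,
  by Cauchy-Schwarz. It will be applied with \<open>c\<close> a basis vector.\<close>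

lemma mpart_bound_inner:
  fixes f :: "'a::euclidean_space \<Rightarrow> 'b::real_inner"
  assumes "open S" "Ck_on k f S" "mpart_bound k M f S" "norm c \<le> 1"
  shows "mpart_bound k M (\<lambda>p. f p \<bullet> c) S"
  using assms(2,3)
proof (induction k arbitrary: f)
  case 0
  show ?case
    unfolding mpart_bound_0
  proof
    fix p assume "p \<in> S"
    with 0 have "norm (f p) * norm c \<le> M * 1"
      using assms(4) by (intro mult_mono) (auto simp: mpart_bound_0 intro: order_trans[OF norm_ge_zero])
    then show "norm (f p \<bullet> c) \<le> M" using Cauchy_Schwarz_ineq2[of "f p" c] by simp
  qed
next
  case (Suc k)
  have "mpart_bound k M (dpart b (\<lambda>p. f p \<bullet> c)) S" if "b \<in> Basis" for b
    by (rule mpart_bound_cong_open[OF assms(1) _ Suc.IH[of "dpart b f"]])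
       (use Suc.prems that in
         \<open>auto simp: mpart_bound_Suc dpart_bounded_linear[OF bounded_linear_inner_left]\<close>)
  moreover have "norm (f p \<bullet> c) \<le> M" if "p \<in> S" for p
  proof -
    have "norm (f p) * norm c \<le> M * 1" using assms(4) Suc.prems that
      by (intro mult_mono) (auto simp: mpart_bound_Suc intro: order_trans[OF norm_ge_zero])
    then show "norm (f p \<bullet> c) \<le> M" using Cauchy_Schwarz_ineq2[of "f p" c] by simp
  qed
  ultimately show ?case by (simp add: mpart_bound_Suc)
qed

text \<open>Bounds on the logarithmic derivative \<open>h\<close> of \<open>j\<close> are bootstrapped to bounds on the derivatives
  of \<open>j\<close> by Leibniz' rule; the constant depends on neither \<open>j\<close> nor \<open>h\<close>.\<close>

lemma mpart_bound_log_derivative: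
  fixes S :: "'a::euclidean_space set"
  assumes S: "open S" and M: "0 \<le> M" and N: "0 \<le> N"
  shows "k \<le> Suc m \<Longrightarrow> \<exists>C\<ge>0. \<forall>j (h :: 'a \<Rightarrow> 'a). Ck_on (Suc m) j S \<and> Ck_on m h S \<and>
     (\<forall>p\<in>S. \<bar>j p\<bar> \<le> M) \<and> mpart_bound m N h S \<and>
     (\<forall>p\<in>S. \<forall>b\<in>Basis. dpart b j p = j p * (h p \<bullet> b)) \<longrightarrow> mpart_bound k C j S"
proof (induction k)
  case 0
  show ?case by (intro exI[of _ M]) (auto simp: mpart_bound_0 M)
next
  case (Suc k)
  then have "k \<le> Suc m" by simp
  from Suc.IH[OF this] obtain C where C: "C \<ge> 0" and bd: "\<And>j (h :: 'a \<Rightarrow> 'a). Ck_on (Suc m) j S \<Longrightarrow>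
      Ck_on m h S \<Longrightarrow> (\<forall>p\<in>S. \<bar>j p\<bar> \<le> M) \<Longrightarrow> mpart_bound m N h S \<Longrightarrow>
      (\<forall>p\<in>S. \<forall>b\<in>Basis. dpart b j p = j p * (h p \<bullet> b)) \<Longrightarrow> mpart_bound k C j S"
    by blast
  \<comment> \<open>\<open>M\<close> takes care of \<open>j\<close> itself. The other entry bounds
    its first derivatives \<open>j * (h \<bullet> b)\<close> up to order \<open>k\<close>, with the
    factor \<open>2 ^ k\<close> from Leibniz' rule.\<close>
  show ?case
  proof (intro exI[of _ "max M (2 ^ k * (C * N))"] conjI allI impI)
    show "0 \<le> max M (2 ^ k * (C * N))" using M by simp
    fix j and h :: "'a \<Rightarrow> 'a"
    assume a: "Ck_on (Suc m) j S \<and> Ck_on m h S \<and> (\<forall>p\<in>S. \<bar>j p\<bar> \<le> M) \<and> mpart_bound m N h S \<and>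
      (\<forall>p\<in>S. \<forall>b\<in>Basis. dpart b j p = j p * (h p \<bullet> b))"
    have "mpart_bound k (2 ^ k * (C * N)) (dpart b j) S" if b: "b \<in> Basis" for b
    proof (rule mpart_bound_cong_open[OF S])
      show "j p * (h p \<bullet> b) = dpart b j p" if "p \<in> S" for p using a b that by simp
      \<comment> \<open>Here \<open>k \<le> m\<close>: to control \<open>j\<close> to order
        \<open>k + 1\<close>, only order \<open>k\<close> of both \<open>j\<close> and
        \<open>h\<close> is used.\<close>
      have h: "Ck_on k h S" "Ck_on k j S"
        using a Suc.prems Ck_on_mono[of m h S k] Ck_on_mono[of "Suc m" j S k] by auto
      show "mpart_bound k (2 ^ k * (C * N)) (\<lambda>p. j p * (h p \<bullet> b)) S"
        by (rule mpart_bound_mult[OF S h(2) _ _ _ C N])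
           (use a b h Suc.prems in \<open>auto simp del: Ck_on.simps simp: C N
              intro!: Ck_on_bounded_linear[OF S bounded_linear_inner_left] bd mpart_bound_inner[OF S]
              intro: mpart_bound_mono\<close>)
    qed
    then show "mpart_bound (Suc k) (max M (2 ^ k * (C * N))) j S"
      using a by (fastforce simp: mpart_bound_Suc intro: mpart_bound_mono)
  qed
qed

lemma C_norm_le:
  assumes "mpart_bound q M f S" "S' \<subseteq> S" "0 \<le> M"
  shows "C_norm q S' f \<le> ennreal (real (Suc q) * M)"
proof -
  have "C_norm q S' f \<le> (\<Sum>k\<le>q. ennreal M)"
    unfolding C_norm_def
    by (intro sum_mono SUP_least) (use assms in \<open>auto simp: mpart_bound_def intro!: ennreal_leI\<close>)
  also have "\<dots> = ennreal (real (Suc q) * M)"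
    using assms(3) by (simp add: ennreal_mult ennreal_of_nat_eq_real_of_nat[symmetric])
  finally show ?thesis .
qed


section \<open>The derivative of the determinant\<close>

text \<open>The product rule is applied to each term of the permutation expansion. After exchanging
  the two sums, the terms with factor \<open>i\<close> differentiated form the determinant whose row
  \<open>i\<close> is replaced by its derivative.\<close>

lemma has_derivative_det:
  fixes A :: "'a::real_normed_vector \<Rightarrow> real ^ 'n ^ 'n"
  assumes "\<And>i j. ((\<lambda>p. A p $ i $ j) has_derivative (\<lambda>v. A' v $ i $ j)) (at p)"
  shows "((\<lambda>p. det (A p)) has_derivative
           (\<lambda>v. \<Sum>i\<in>UNIV. det (\<chi> k. if k = i then A' v $ i else A p $ k))) (at p)"
proof -
  have "((\<lambda>p. det (A p)) has_derivative
      (\<lambda>v. \<Sum>\<sigma>\<in>{\<sigma>. \<sigma> permutes (UNIV::'n set)}. of_int (sign \<sigma>) *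
         (\<Sum>i\<in>UNIV. A' v $ i $ \<sigma> i * (\<Prod>j\<in>UNIV - {i}. A p $ j $ \<sigma> j)))) (at p)"
    unfolding det_def by (intro has_derivative_sum has_derivative_mult_right has_derivative_prod assms)
  moreover have "(\<Sum>\<sigma>\<in>{\<sigma>. \<sigma> permutes (UNIV::'n set)}. of_int (sign \<sigma>) *
      (\<Sum>i\<in>UNIV. A' v $ i $ \<sigma> i * (\<Prod>j\<in>UNIV - {i}. A p $ j $ \<sigma> j))) =
      (\<Sum>i\<in>UNIV. det (\<chi> k. if k = i then A' v $ i else A p $ k))" for v
  proof -
    have "(\<Prod>k\<in>UNIV. (\<chi> k. if k = i then A' v $ i else A p $ k) $ k $ \<sigma> k) =
        A' v $ i $ \<sigma> i * (\<Prod>j\<in>UNIV - {i}. A p $ j $ \<sigma> j)" for i and \<sigma> :: "'n \<Rightarrow> 'n"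
      by (subst prod.remove[of _ i]) auto
    then show ?thesis
      unfolding det_def sum_distrib_left by (subst sum.swap) simp
  qed
  ultimately show ?thesis by simp
qed

text \<open>Row \<open>i\<close> of \<open>A' v\<close> is a combination of the rows of
  \<open>A p\<close> with coefficients \<open>C $ i\<close>, so substituting it for row
  \<open>i\<close> multiplies the determinant by \<open>C $ i $ i\<close>. Writing
  \<open>A' v = C ** A p\<close> keeps the inverse matrix out of the statement.\<close>

lemma Jacobi_formula:
  fixes A :: "'a::real_normed_vector \<Rightarrow> real ^ 'n ^ 'n"
  assumes "\<And>i j. ((\<lambda>p. A p $ i $ j) has_derivative (\<lambda>v. A' v $ i $ j)) (at p)"
    and "A' v = C ** A p"
  shows "dpart v (\<lambda>p. det (A p)) p = trace C * det (A p)"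
proof -
  have "det (\<chi> k. if k = i then A' v $ i else A p $ k) = C $ i $ i * det (A p)" for i
  proof -
    have "A' v $ i = (\<Sum>l\<in>UNIV. C $ i $ l *s row l (A p))"
      by (simp add: assms(2) vec_eq_iff matrix_matrix_mult_def row_def)
    then have "(\<chi> k. if k = i then A' v $ i else A p $ k) =
        (\<chi> k. if k = i then \<Sum>l\<in>UNIV. C $ i $ l *s row l (A p) else row k (A p))"
      by (simp add: vec_eq_iff row_def)
    then show ?thesis using cramer_lemma_transpose[of i "C $ i" "A p"] by simp
  qed
  then show ?thesis
    by (simp add: dpart_eq_derivative[OF has_derivative_det[OF assms(1)]] trace_def sum_distrib_right)
qed

section \<open>The functions describing the foliation\<close>

lemma dirx_in_Basis: "dirx i \<in> Basis" and diry_in_Basis: "diry k \<in> Basis"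
  by (auto simp: dirx_def diry_def Basis_prod_def axis_in_Basis_iff)

lemma dpart_sum_scaleR:
  assumes "f differentiable (at z)"
  shows "dpart (\<Sum>i\<in>I. c i *\<^sub>R v i) f z = (\<Sum>i\<in>I. c i *\<^sub>R dpart (v i) f z)"
proof -
  have lin: "linear (\<lambda>v. dpart v f z)"
    using has_derivative_dpart[OF assms] by (rule has_derivative_linear)
  show ?thesis
    using linear_sum[OF lin, of "\<lambda>i. c i *\<^sub>R v i" I] linear_cmul[OF lin] by simp
qed

section \<open>Leaves in a chart and injectivity of \<open>fol_map\<close>\<close>

lemma open_U0: "open (U0 \<delta>)"
  by (simp add: U0_def open_Times)

text \<open>A path component is empty when its base point lies outside the set. The graph condition
  supplies some point of it, and the path to that point starts at the base point.\<close>

lemma base_mem_chart_leaf: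
  fixes \<kappa> :: "'m \<Rightarrow> ('m, 'u::finite, 's::finite) chart" and y :: "real ^ 's"
  assumes "chart_leaves_are_graphs \<delta> \<kappa> W \<xi>" "(x, y) \<in> U0 \<delta>"
  shows "(x, 0) + cmap (\<kappa> \<xi>) \<xi> \<in> chart_leaf \<delta> \<kappa> W \<xi> x"
proof -
  from assms obtain u where "(u, y) + cmap (\<kappa> \<xi>) \<xi> \<in> chart_leaf \<delta> \<kappa> W \<xi> x"
    unfolding chart_leaves_are_graphs_def by blast
  then show ?thesis
    unfolding chart_leaf_def Let_def by (auto dest!: path_component_mem(1) intro: path_component_refl)
qed

lemma fol_fun_mem_chart_leaf:
  fixes \<kappa> :: "'m \<Rightarrow> ('m, 'u::finite, 's::finite) chart" and y :: "real ^ 's"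
  assumes "chart_leaves_are_graphs \<delta> \<kappa> W \<xi>" "(x, y) \<in> U0 \<delta>"
  shows "(fol_fun \<delta> \<kappa> W \<xi> (x, y), y) + cmap (\<kappa> \<xi>) \<xi> \<in> chart_leaf \<delta> \<kappa> W \<xi> x"
  proof -
  have "\<exists>!u. (u, y) + cmap (\<kappa> \<xi>) \<xi> \<in> chart_leaf \<delta> \<kappa> W \<xi> x"
    using assms unfolding chart_leaves_are_graphs_def by blast
  from theI'[OF this] show ?thesis by (simp add: fol_fun_def)
qed

lemma fol_fun_eqI:
  fixes \<kappa> :: "'m \<Rightarrow> ('m, 'u::finite, 's::finite) chart" and y :: "real ^ 's"
  assumes "chart_leaves_are_graphs \<delta> \<kappa> W \<xi>" "(x, y) \<in> U0 \<delta>"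
    and "(u, y) + cmap (\<kappa> \<xi>) \<xi> \<in> chart_leaf \<delta> \<kappa> W \<xi> x"
  shows "fol_fun \<delta> \<kappa> W \<xi> (x, y) = u"
  using assms fol_fun_mem_chart_leaf[OF assms(1,2)]
  unfolding chart_leaves_are_graphs_def by blast

lemma fol_fun_0:
  fixes \<kappa> :: "'m \<Rightarrow> ('m, 'u::finite, 's::finite) chart"
  assumes "chart_leaves_are_graphs \<delta> \<kappa> W \<xi>" "(x, 0 :: real ^ 's) \<in> U0 \<delta>"
  shows "fol_fun \<delta> \<kappa> W \<xi> (x, 0) = x"
  by (rule fol_fun_eqI[OF assms base_mem_chart_leaf[OF assms]])

text \<open>The union defining \<open>leaf\<close> has a single member, because the sets of a
  partition are disjoint.\<close>

lemma leaf_eq: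
  assumes "partition_on UNIV W" "a \<in> leaf W p"
  shows "leaf W a = leaf W p"
proof -
  obtain A where A: "A \<in> W" "p \<in> A" "a \<in> A" using assms(2) by (auto simp: leaf_def)
  then have "{B \<in> W. p \<in> B} = {A}" "{B \<in> W. a \<in> B} = {A}"
    using assms(1) unfolding partition_on_def disjoint_def by blast+
  then show ?thesis by (simp add: leaf_def)
qed

text \<open>A common point belongs, by injectivity of the chart, to one global leaf. Both chart
  leaves are therefore path components of the same set, and these coincide once they meet.\<close>

lemma chart_leaf_eq:
  assumes "partition_on UNIV W" "inj_on (cmap (\<kappa> \<xi>)) (cdom (\<kappa> \<xi>))"
    and "z \<in> chart_leaf \<delta> \<kappa> W \<xi> x" "z \<in> chart_leaf \<delta> \<kappa> W \<xi> x'"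
  shows "chart_leaf \<delta> \<kappa> W \<xi> x = chart_leaf \<delta> \<kappa> W \<xi> x'"
proof -
  define c where "c = \<kappa> \<xi>"
  define P where "P x = cmap c ` (leaf W (cinv c ((x, 0) + cmap c \<xi>)) \<inter> cdom c) \<inter>
    (UNIV \<times> ball (snd (cmap c \<xi>)) (\<delta> / 2))" for x
  have cl: "chart_leaf \<delta> \<kappa> W \<xi> x = path_component_set (P x) ((x, 0) + cmap c \<xi>)" for x
    by (simp add: chart_leaf_def P_def c_def Let_def)
  have "z \<in> P x" "z \<in> P x'"
    using assms(3,4) by (auto simp: cl dest: path_component_mem)
  then obtain a a' where "z = cmap c a" "a \<in> leaf W (cinv c ((x, 0) + cmap c \<xi>))" "a \<in> cdom c"
    "z = cmap c a'" "a' \<in> leaf W (cinv c ((x', 0) + cmap c \<xi>))" "a' \<in> cdom c"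
    by (auto simp: P_def)
  moreover from this have "a = a'" using assms(2) by (auto simp: c_def dest: inj_onD)
  ultimately have "P x = P x'"
    using leaf_eq[OF assms(1)] by (simp add: P_def) metis
  moreover have "path_component_set (P x) ((x, 0) + cmap c \<xi>) = path_component_set (P x) z"
    "path_component_set (P x') ((x', 0) + cmap c \<xi>) = path_component_set (P x') z"
    using assms(3,4) by (simp_all add: cl path_component_eq)
  ultimately show ?thesis by (simp add: cl)
qed

text \<open>Equal images have the same y and lie on a common chart leaf. That leaf contains the base
  points over both \<open>x\<close> and \<open>x'\<close>, but only one point over y = 0.\<close>

lemma fol_map_inj_on:
  fixes \<kappa> :: "'m \<Rightarrow> ('m, 'u::finite, 's::finite) chart"
  assumes "partition_on UNIV W" "inj_on (cmap (\<kappa> \<xi>)) (cdom (\<kappa> \<xi>))"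
    and G: "chart_leaves_are_graphs \<delta> \<kappa> W \<xi>"
  shows "inj_on (fol_map \<delta> \<kappa> W \<xi>) (U0 \<delta>)"
proof (rule inj_onI)
  fix z z' :: "('u, 's) model"
  assume z: "z \<in> U0 \<delta>" "z' \<in> U0 \<delta>" and eq: "fol_map \<delta> \<kappa> W \<xi> z = fol_map \<delta> \<kappa> W \<xi> z'"
  obtain x y x' where xy: "z = (x, y)" "z' = (x', y)"
    using eq by (cases z; cases z') (auto simp: fol_map_def)
  then have eq': "fol_fun \<delta> \<kappa> W \<xi> (x, y) = fol_fun \<delta> \<kappa> W \<xi> (x', y)"
    using eq by (simp add: fol_map_def)
  have "chart_leaf \<delta> \<kappa> W \<xi> x = chart_leaf \<delta> \<kappa> W \<xi> x'"
    by (rule chart_leaf_eq[OF assms(1,2) fol_fun_mem_chart_leaf[OF G, of x y]])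
       (use z xy eq' fol_fun_mem_chart_leaf[OF G, of x' y] in auto)
  then have "(x', 0) + cmap (\<kappa> \<xi>) \<xi> \<in> chart_leaf \<delta> \<kappa> W \<xi> x"
    using base_mem_chart_leaf[OF G, of x' y] z xy by simp
  moreover have "(x, 0) \<in> U0 \<delta>"
    using z xy by (auto simp: U0_def) (smt (verit) norm_ge_zero)
  ultimately have "fol_fun \<delta> \<kappa> W \<xi> (x, 0) = x'" "fol_fun \<delta> \<kappa> W \<xi> (x, 0) = x"
    by (auto intro: fol_fun_eqI[OF G] fol_fun_0[OF G])
  then show "z = z'" by (simp add: xy)
qed

section \<open>The Jacobian matrix in x and the y-derivative of its determinant\<close>

definition xjac :: "(('u::finite, 's::finite) model \<Rightarrow> real ^ 'u) \<Rightarrow> ('u, 's) model \<Rightarrow> real ^ 'u ^ 'u" where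
  "xjac F z = (\<chi> j i. dpart (dirx i) (\<lambda>w. F w $ j) z)"

lemma Ck_on_nth:
  assumes "open S" "Ck_on k F S"
  shows "Ck_on k (\<lambda>w. F w $ j) S"
  by (rule Ck_on_bounded_linear[OF assms(1) bounded_linear_vec_nth assms(2)])

lemma Ck_on_det_xjac:
  assumes "open S" "Ck_on (Suc k) F S"
  shows "Ck_on k (\<lambda>z. det (xjac F z)) S"
  by (rule Ck_on_det[OF assms(1)])
     (use Ck_on_dpart[OF Ck_on_nth[OF assms] dirx_in_Basis] in \<open>simp add: xjac_def\<close>)

lemma dpart_eq_xjac:
  fixes F :: "('u::finite, 's::finite) model \<Rightarrow> real ^ 'u"
  assumes "F differentiable (at z)"
  shows "dpart (a, b) F z = xjac F z *v a + dpart (0, b) F z"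
proof -
  have lin: "linear (\<lambda>v. dpart v F z)"
    using has_derivative_dpart[OF assms] by (rule has_derivative_linear)
  have "dpart (a, b) F z = dpart (a, 0) F z + dpart (0, b) F z"
    using linear_add[OF lin, of "(a, 0)" "(0, b)"] by simp
  moreover have "dpart (a, 0) F z = xjac F z *v a"
  proof -
    have "(a, 0) = (\<Sum>i\<in>UNIV. a $ i *\<^sub>R (dirx i :: ('u, 's) model))"
    proof (rule prod_eqI)
      show "fst (a, 0) = fst (\<Sum>i\<in>UNIV. a $ i *\<^sub>R (dirx i :: ('u, 's) model))"
        by (simp add: fst_sum dirx_def basis_expansion flip: scalar_mult_eq_scaleR)
    qed (simp add: snd_sum dirx_def)
    then have "dpart (a, 0) F z = (\<Sum>i\<in>UNIV. a $ i *\<^sub>R dpart (dirx i) F z)"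
      by (simp only: dpart_sum_scaleR[OF assms])
    moreover have "dpart (dirx i) (\<lambda>w. F w $ j) z = dpart (dirx i) F z $ j" for i j
      by (rule dpart_bounded_linear[OF bounded_linear_vec_nth assms])
    ultimately show ?thesis
      by (simp add: vec_eq_iff matrix_vector_mult_def xjac_def mult.commute)
  qed
  ultimately show ?thesis by simp
qed

text \<open>With \<open>A = \<partial>\<^sub>xF\<close>, the right-hand side is \<open>det A\<close> times the trace of \<open>(\<partial>\<^sub>y\<^sub>kA)A\<inverse>\<close>, because the
  differential of the inverse of \<open>(x, y) \<mapsto> (F(x, y), y)\<close> maps \<open>(e\<^sub>j, 0)\<close> to \<open>(A\<inverse>e\<^sub>j, 0)\<close>.\<close>

lemma dpart_det_xjac:
  fixes F :: "('u::finite, 's::finite) model \<Rightarrow> real ^ 'u"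
  defines "G \<equiv> \<lambda>z. (F z, snd z)"
  assumes S: "open S" and F: "Ck_on 2 F S" and inj: "inj_on G S" and z: "z \<in> S"
    and nz: "det (xjac F z) \<noteq> 0"
  shows "dpart (diry k) (\<lambda>z. det (xjac F z)) z =
    det (xjac F z) *
      (\<Sum>j\<in>UNIV. dpart (dirx j) (dpart (diry k) (\<lambda>w. F w $ j) \<circ> the_inv_into S G) (G z))"
proof -
  define A where "A = xjac F z"
  obtain A' where A': "A ** A' = mat 1" "A' ** A = mat 1"
    using nz invertible_det_nz[of A] by (auto simp: A_def invertible_def)
  have F1: "F differentiable (at p)" if "p \<in> S" for p
    using F that by (simp add: numeral_2_eq_2)
  have Fj: "Ck_on (Suc (Suc 0)) (\<lambda>w. F w $ j) S" for j
    using Ck_on_nth[OF S F] by (simp add: numeral_2_eq_2)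
  \<comment> \<open>The candidate inverse of the differential of \<open>G\<close>: the equation
    \<open>A *v a + dpart (0, d) F z = c\<close> is solved for \<open>a\<close>.\<close>
  define g' where "g' = (\<lambda>(c, d). (A' *v (c - dpart (0, d) F z), d))"
  have derG: "(G has_derivative (\<lambda>v. (dpart v F z, snd v))) (at z)"
    unfolding G_def by (intro derivative_intros has_derivative_dpart F1 z)
  have contG: "continuous_on S G"
    unfolding G_def using F1
    by (intro continuous_intros continuous_at_imp_continuous_on)
       (auto intro: differentiable_imp_continuous_within)
  \<comment> \<open>For a continuous injective map on an open set, a right inverse of the
    differential at \<open>z\<close> already makes the inverse map differentiable at the image
    point.\<close>
  have "(\<lambda>v. (dpart v F z, snd v)) \<circ> g' = id"
    by (auto simp: fun_eq_iff g'_def dpart_eq_xjac[OF F1[OF z], of "_ *v _"]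
        matrix_vector_mul_assoc A' A_def[symmetric])
  then have inv: "(the_inv_into S G has_derivative g') (at (G z))"
    using the_inv_into_f_f[OF inj] by (intro has_derivative_inverse_strong[OF S z contG _ derG])
  have inv_z: "the_inv_into S G (G z) = z"
    by (rule the_inv_into_f_f[OF inj z])
  define B where "B = (\<chi> j i. dpart (diry k) (dpart (dirx i) (\<lambda>w. F w $ j)) z)"
  have lin0: "dpart (0, 0) F z = 0"
    using linear_0[OF has_derivative_linear[OF has_derivative_dpart[OF F1[OF z]]]]
    by (simp add: zero_prod_def)
  have "dpart (dirx j) (dpart (diry k) (\<lambda>w. F w $ j) \<circ> the_inv_into S G) (G z) = (B ** A') $ j $ j"
    for j
  proof -
    let ?E = "dpart (diry k) (\<lambda>w. F w $ j)"
    have E: "?E differentiable (at z)"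
      by (rule Ck_on_imp_differentiable[OF Ck_on_dpart[OF Fj diry_in_Basis] z])
    have "((?E \<circ> the_inv_into S G) has_derivative (\<lambda>v. dpart v ?E z) \<circ> g') (at (G z))"
      by (rule diff_chain_at[OF inv]) (simp add: inv_z has_derivative_dpart[OF E])
    then have "dpart (dirx j) (?E \<circ> the_inv_into S G) (G z) = dpart (g' (dirx j)) ?E z"
      by (simp add: dpart_eq_derivative)
    also have "g' (dirx j) = (\<Sum>i\<in>UNIV. A' $ i $ j *\<^sub>R dirx i)"
    proof (rule prod_eqI)
      have "A' *v axis j 1 = (\<Sum>i\<in>UNIV. A' $ i $ j *\<^sub>R axis i 1)"
        by (simp add: vec_eq_iff matrix_vector_mult_def axis_def if_distrib cong: if_cong)
      then show "fst (g' (dirx j)) = fst (\<Sum>i\<in>UNIV. A' $ i $ j *\<^sub>R dirx i)"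
        by (simp add: fst_sum dirx_def g'_def lin0)
    qed (simp add: snd_sum dirx_def g'_def)
    also have "dpart \<dots> ?E z = (\<Sum>i\<in>UNIV. A' $ i $ j *\<^sub>R dpart (dirx i) ?E z)"
      by (rule dpart_sum_scaleR[OF E])
    also have "\<dots> = (B ** A') $ j $ j"
    proof -
      \<comment> \<open>Symmetry of second derivatives turns the x-derivative of the y-derivative of
        \<open>F\<close> into an entry of the y-derivative of \<open>A\<close>.\<close>
      have "dpart (dirx i) ?E z = B $ j $ i" for i
        using dpart_commute[OF S _ dirx_in_Basis diry_in_Basis z, of "\<lambda>w. F w $ j"] Ck_on_nth[OF S F]
        by (simp add: B_def)
      then show ?thesis by (simp add: matrix_matrix_mult_def mult.commute)
    qed
    finally show ?thesis .
  qed
  \<comment> \<open>The y-derivative of \<open>A\<close> is \<open>B = (B ** A') ** A\<close>, so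
    Jacobi's formula applies with \<open>C = B ** A'\<close>.\<close>
  moreover have "dpart (diry k) (\<lambda>z. det (xjac F z)) z = trace (B ** A') * det (xjac F z)"
  proof (rule Jacobi_formula)
    show "((\<lambda>p. xjac F p $ i $ j) has_derivative
        (\<lambda>v. (\<chi> j i. dpart v (dpart (dirx i) (\<lambda>w. F w $ j)) z) $ i $ j)) (at z)" for i j
      using has_derivative_dpart[OF Ck_on_imp_differentiable[OF Ck_on_dpart[OF Fj dirx_in_Basis] z]]
      by (simp add: xjac_def)
    show "(\<chi> j i. dpart (diry k) (dpart (dirx i) (\<lambda>w. F w $ j)) z) = B ** A' ** xjac F z"
      by (simp add: A' A_def[symmetric] B_def[symmetric] flip: matrix_mul_assoc)
  qed
  ultimately show ?thesis by (simp add: trace_def)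
qed

section \<open>The Jacobian of the holonomy\<close>

text \<open>A zero of \<open>\<phi>\<close> could not be reached from \<open>\<phi>(0) = 1\<close>, since \<open>\<phi>(t)e\<^sup>c\<^sup>t\<close> increases as long as
  \<open>\<phi>\<close> does not vanish.\<close>

lemma log_derivative_bound_pos:
  fixes \<phi> \<phi>' :: "real \<Rightarrow> real"
  assumes \<phi>0: "\<phi> 0 = 1" and c: "0 \<le> c"
    and der: "\<And>t. 0 \<le> t \<Longrightarrow> t \<le> 1 \<Longrightarrow> (\<phi> has_real_derivative \<phi>' t) (at t)"
    and bd: "\<And>t. 0 \<le> t \<Longrightarrow> t \<le> 1 \<Longrightarrow> \<phi> t \<noteq> 0 \<Longrightarrow> \<bar>\<phi>' t\<bar> \<le> c * \<bar>\<phi> t\<bar>"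
  shows "0 < \<phi> 1" "\<phi> 1 \<le> exp c"
proof -
  have cont: "continuous_on {0..1} \<phi>"
    by (rule DERIV_continuous_on[OF has_field_derivative_at_within[OF der]]) auto
  \<comment> \<open>By the intermediate value theorem a function without zeros keeps the sign of
    \<open>\<phi> 0 = 1\<close>.\<close>
  have pos_of_nz: "\<phi> t > 0" if "0 \<le> t" "t \<le> 1" and nz: "\<And>s. 0 \<le> s \<Longrightarrow> s \<le> t \<Longrightarrow> \<phi> s \<noteq> 0" for t
  proof (rule ccontr)
    assume "\<not> \<phi> t > 0"
    then have "\<exists>s\<ge>0. s \<le> t \<and> \<phi> s = 0"
      using that \<phi>0 by (intro IVT2' continuous_on_subset[OF cont]) auto
    with nz show False by auto
  qed
  have nz: "\<phi> t \<noteq> 0" if "0 \<le> t" "t \<le> 1" for t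
  proof
    assume z: "\<phi> t = 0"
    define Z where "Z = {s \<in> {0..1}. \<phi> s = 0}"
    \<comment> \<open>The first zero, attained because \<open>Z\<close> is closed; the function is
      positive before it.\<close>
    define s where "s = Inf Z"
    have "closed Z"
      unfolding Z_def using cont by (intro continuous_closed_preimage_constant) auto
    moreover have "Z \<noteq> {}" "bdd_below Z" using z that by (auto simp: Z_def intro: bdd_belowI[of _ 0])
    ultimately have "s \<in> Z" and le: "\<And>u. u \<in> Z \<Longrightarrow> s \<le> u"
      by (auto simp: s_def closed_contains_Inf cInf_lower)
    then have s: "0 \<le> s" "s \<le> 1" "\<phi> s = 0" by (auto simp: Z_def)
    have pos: "\<phi> u > 0" if "0 \<le> u" "u < s" for u
    proof (rule pos_of_nz)
      show "\<phi> v \<noteq> 0" if "0 \<le> v" "v \<le> u" for v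
        using le[of v] that \<open>u < s\<close> s by (auto simp: Z_def)
    qed (use that s in auto)
    have "\<phi> 0 * exp (c * 0) \<le> \<phi> s * exp (c * s)"
    proof (rule DERIV_nonneg_imp_increasing_open[of 0 s "\<lambda>u. \<phi> u * exp (c * u)"])
      show "continuous_on {0..s} (\<lambda>u. \<phi> u * exp (c * u))"
        using s by (intro continuous_intros continuous_on_subset[OF cont]) auto
      fix u assume u: "0 < u" "u < s"
      have "((\<lambda>u. \<phi> u * exp (c * u)) has_real_derivative (\<phi>' u + c * \<phi> u) * exp (c * u)) (at u)"
        using u s by (auto intro!: derivative_eq_intros der simp: algebra_simps)
      moreover have "0 \<le> (\<phi>' u + c * \<phi> u) * exp (c * u)"
        using bd[of u] pos[of u] u s by (intro mult_nonneg_nonneg) auto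
      ultimately show "\<exists>y. ((\<lambda>u. \<phi> u * exp (c * u)) has_real_derivative y) (at u) \<and> 0 \<le> y" by blast
    qed (use s in auto)
    then show False using s \<phi>0 by simp
  qed
  then have pos: "\<phi> t > 0" if "0 \<le> t" "t \<le> 1" for t
    using that by (intro pos_of_nz) auto
  then show "0 < \<phi> 1" by simp
  \<comment> \<open>With positivity known, \<open>\<phi> u * exp (- c * u)\<close> is
    non-increasing; the minus sign turns this into a statement about an increasing function.\<close>
  have "- (\<phi> 0 * exp (- c * 0)) \<le> - (\<phi> 1 * exp (- c * 1))"
  proof (rule DERIV_nonneg_imp_increasing_open[of 0 1 "\<lambda>u. - (\<phi> u * exp (- c * u))"])
    show "continuous_on {0..1} (\<lambda>u. - (\<phi> u * exp (- c * u)))"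
      by (intro continuous_intros cont)
    fix u :: real assume u: "0 < u" "u < 1"
    have "((\<lambda>u. - (\<phi> u * exp (- c * u))) has_real_derivative (c * \<phi> u - \<phi>' u) * exp (- c * u)) (at u)"
      using u by (auto intro!: derivative_eq_intros der simp: algebra_simps)
    moreover have "0 \<le> (c * \<phi> u - \<phi>' u) * exp (- c * u)"
      using bd[of u] pos[of u] u by (intro mult_nonneg_nonneg) auto
    ultimately show "\<exists>y. ((\<lambda>u. - (\<phi> u * exp (- c * u))) has_real_derivative y) (at u) \<and> 0 \<le> y"
      by blast
  qed auto
  then show "\<phi> 1 \<le> exp c"
    using \<phi>0 by (simp add: exp_minus field_simps)
qed

section \<open>Derivative, positivity and bounds for the Jacobian of the foliation\<close>

lemma fol_J_eq_det: "fol_J \<delta> \<kappa> W \<xi> = (\<lambda>z. det (xjac (fol_fun \<delta> \<kappa> W \<xi>) z))"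
  by (rule ext) (simp add: fol_J_def xjac_def)

lemma Ck_on_fol_fun:
  assumes "W \<in> regular_cone_foliations \<A> r K \<delta> \<kappa>"
  shows "Ck_on r (fol_fun \<delta> \<kappa> W \<xi>) (U0 \<delta>)"
proof -
  have "Ck_on r (\<lambda>z. fst (fol_map \<delta> \<kappa> W \<xi> z)) (U0 \<delta>)"
    using assms by (intro Ck_on_bounded_linear[OF open_U0 bounded_linear_fst])
      (auto simp: regular_cone_foliations_def)
  then show ?thesis by (simp add: fol_map_def)
qed

lemma Ck_on_fol_J:
  assumes "W \<in> regular_cone_foliations \<A> (Suc k) K \<delta> \<kappa>"
  shows "Ck_on k (fol_J \<delta> \<kappa> W \<xi>) (U0 \<delta>)"
  unfolding fol_J_eq_det by (rule Ck_on_det_xjac[OF open_U0 Ck_on_fol_fun[OF assms]])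

text \<open>Non-vanishing of the Jacobian is still a hypothesis here; it is established in
  \<open>fol_J_pos_bounded\<close>, which invokes this formula only off the zeros.\<close>

lemma dpart_fol_J:
  assumes W: "W \<in> regular_cone_foliations \<A> r K \<delta> \<kappa>" and r: "2 \<le> r"
    and "is_atlas r \<A>" "chart_choice \<A> \<delta>' \<kappa>"
    and z: "z \<in> U0 \<delta>" and nz: "fol_J \<delta> \<kappa> W \<xi> z \<noteq> 0"
  shows "dpart (diry k) (fol_J \<delta> \<kappa> W \<xi>) z = fol_J \<delta> \<kappa> W \<xi> z * fol_H \<delta> \<kappa> W \<xi> z $ k"
proof -
  have map: "fol_map \<delta> \<kappa> W \<xi> = (\<lambda>z. (fol_fun \<delta> \<kappa> W \<xi> z, snd z))"
    by (rule ext) (simp add: fol_map_def)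
  have "homeomorphism (cdom (\<kappa> \<xi>)) (crange (\<kappa> \<xi>)) (cmap (\<kappa> \<xi>)) (cinv (\<kappa> \<xi>))"
    using assms(3,4) by (auto simp: is_atlas_def chart_choice_def)
  then have "inj_on (cmap (\<kappa> \<xi>)) (cdom (\<kappa> \<xi>))"
    by (auto simp: homeomorphism_def inj_on_def) metis
  then have "inj_on (fol_map \<delta> \<kappa> W \<xi>) (U0 \<delta>)"
    using W by (intro fol_map_inj_on)
      (auto simp: regular_cone_foliations_def cone_foliations_def foliation_def)
  then show ?thesis
    using dpart_det_xjac[OF open_U0 Ck_on_mono[OF Ck_on_fol_fun[OF W] r] _ z, of \<xi> k] nz
    by (simp add: fol_J_eq_det fol_H_def map)
qed

text \<open>Derivatives in x at points with y = 0 see only the slice y = 0, where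
  \<open>F(x, 0) = x\<close>, so the Jacobian matrix is the identity.\<close>

lemma fol_J_0:
  fixes \<kappa> :: "'m \<Rightarrow> ('m, 'u::finite, 's::finite) chart"
  assumes G: "chart_leaves_are_graphs \<delta> \<kappa> W \<xi>" and z: "(x, 0 :: real ^ 's) \<in> U0 \<delta>"
  shows "fol_J \<delta> \<kappa> W \<xi> (x, 0) = 1"
proof -
  have "{u. (u, 0 :: real ^ 's) \<in> U0 \<delta>} = ball 0 (\<delta> / 2)"
    using z by (auto simp: U0_def)
  then have open_ball: "open {u. (u, 0 :: real ^ 's) \<in> U0 \<delta>}" "x \<in> {u. (u, 0 :: real ^ 's) \<in> U0 \<delta>}"
    using z by (metis open_ball) (use z in simp)
  have "dpart (dirx i) (\<lambda>w. fol_fun \<delta> \<kappa> W \<xi> w $ j) (x, 0) = (if j = i then 1 else 0)" for i j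
  proof -
    have "dpart (dirx i) (\<lambda>w. fol_fun \<delta> \<kappa> W \<xi> w $ j) (x, 0) =
        dpart (axis i 1) (\<lambda>u. fol_fun \<delta> \<kappa> W \<xi> (u, 0) $ j) x"
      by (simp add: dpart_def dirx_def)
    also have "\<dots> = dpart (axis i 1) (\<lambda>u. u $ j) x"
      by (rule dpart_cong_open[OF open_ball]) (simp add: fol_fun_0[OF G])
    also have "\<dots> = axis i 1 $ j"
      by (intro dpart_eq_derivative bounded_linear_imp_has_derivative bounded_linear_vec_nth)
    finally show ?thesis by (simp add: axis_def)
  qed
  then show ?thesis
    by (simp add: fol_J_def flip: mat_def)
qed

lemma W_class_imp_regular: "W \<in> W_class \<A> r K \<delta> \<kappa> L \<Longrightarrow> W \<in> regular_cone_foliations \<A> r K \<delta> \<kappa>"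
  by (simp add: W_class_def)

lemma W_class_fol_H_bound:
  assumes "W \<in> W_class \<A> r K \<delta> \<kappa> L" "length \<alpha> + 2 \<le> r" "z \<in> U0 \<delta>"
  shows "norm (mpart (map diry \<alpha>) (fol_H \<delta> \<kappa> W \<xi>) z) \<le> L ^ ((length \<alpha> + 1)\<^sup>2)"
  using assms unfolding W_class_def Let_def by blast

text \<open>Linearity passes from coordinate directions to arbitrary ones, such as that of the
  segment joining \<open>(x, 0)\<close> to \<open>(x, y)\<close>.\<close>

lemma dpart_y_eq_sum:
  fixes f :: "('u::finite, 's::finite) model \<Rightarrow> real"
  assumes "f differentiable (at z)" "\<And>k. dpart (diry k) f z = c * h $ k"
  shows "dpart (0, v) f z = c * (h \<bullet> v)"
proof -
  have "(0, v) = (\<Sum>k\<in>UNIV. v $ k *\<^sub>R (diry k :: ('u, 's) model))"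
  proof (rule prod_eqI)
    show "snd (0, v) = snd (\<Sum>k\<in>UNIV. v $ k *\<^sub>R (diry k :: ('u, 's) model))"
      by (simp add: snd_sum diry_def basis_expansion flip: scalar_mult_eq_scaleR)
  qed (simp add: fst_sum diry_def)
  then have "dpart (0, v) f z = (\<Sum>k\<in>UNIV. v $ k *\<^sub>R dpart (diry k) f z)"
    by (simp only: dpart_sum_scaleR[OF assms(1)])
  then show ?thesis
    by (simp add: assms(2) inner_vec_def sum_distrib_left mult_ac)
qed

text \<open>Along \<open>(x, t y)\<close> the logarithmic derivative of the Jacobian is
  \<open>H \<bullet> y\<close>, of size at most \<open>L * norm y\<close>. The start value is 1, and
  \<open>norm y < \<delta>\<close> makes the bound uniform.\<close>

lemma fol_J_pos_bounded:
  assumes W: "W \<in> W_class \<A> r K \<delta> \<kappa> L" and r: "2 \<le> r" and L: "0 < L"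
    and "is_atlas r \<A>" "chart_choice \<A> \<delta>' \<kappa>"
    and z: "(x, y) \<in> U0 \<delta>"
  shows "0 < fol_J \<delta> \<kappa> W \<xi> (x, y)" "fol_J \<delta> \<kappa> W \<xi> (x, y) \<le> exp (L * \<delta>)"
proof -
  let ?J = "fol_J \<delta> \<kappa> W \<xi>" and ?H = "fol_H \<delta> \<kappa> W \<xi>"
  note W' = W_class_imp_regular[OF W]
  have U: "(x, t *\<^sub>R y) \<in> U0 \<delta>" if "0 \<le> t" "t \<le> 1" for t
    using z that mult_left_le_one_le[of "norm y" t] by (auto simp: U0_def)
  have diff: "?J differentiable (at p)" if "p \<in> U0 \<delta>" for p
  proof (rule Ck_on_imp_differentiable[OF _ that])
    show "Ck_on (Suc 0) ?J (U0 \<delta>)"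
      using W' r Ck_on_mono[OF Ck_on_fol_J[of W \<A> "r - 1"], of _ _ _ "Suc 0"] by simp
  qed
  have der: "((\<lambda>t. ?J (x, t *\<^sub>R y)) has_real_derivative dpart (0, y) ?J (x, t *\<^sub>R y)) (at t)"
    if "0 \<le> t" "t \<le> 1" for t
    using has_real_derivative_dpart[of ?J "(x, 0)" t "(0, y)"] diff[OF U[OF that]] by simp
  have bd: "\<bar>dpart (0, y) ?J (x, t *\<^sub>R y)\<bar> \<le> L * norm y * \<bar>?J (x, t *\<^sub>R y)\<bar>"
    if t: "0 \<le> t" "t \<le> 1" and nz: "?J (x, t *\<^sub>R y) \<noteq> 0" for t
  proof -
    \<comment> \<open>The class bound for the empty multi-index, whose exponent is 1; it is
      available because \<open>2 \<le> r\<close>.\<close>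
    have "norm (?H (x, t *\<^sub>R y)) \<le> L"
      using W_class_fol_H_bound[OF W, of "[]" "(x, t *\<^sub>R y)" \<xi>] U[OF t] r by simp
    then have "\<bar>?H (x, t *\<^sub>R y) \<bullet> y\<bar> \<le> L * norm y"
      by (meson Cauchy_Schwarz_ineq2 mult_right_mono norm_ge_zero order_trans)
    moreover have "dpart (0, y) ?J (x, t *\<^sub>R y) = ?J (x, t *\<^sub>R y) * (?H (x, t *\<^sub>R y) \<bullet> y)"
      by (intro dpart_y_eq_sum diff U t dpart_fol_J[OF W' r assms(4,5)] nz)
    ultimately show ?thesis
      using mult_right_mono[of _ "L * norm y" "\<bar>?J (x, t *\<^sub>R y)\<bar>"]
      by (simp add: abs_mult mult.commute[of "\<bar>?J _\<bar>"])
  qed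
  have "?J (x, 0 *\<^sub>R y) = 1"
    using W' U[of 0] by (auto intro: fol_J_0 simp: regular_cone_foliations_def)
  note * = log_derivative_bound_pos[OF this _ der bd]
  show "0 < ?J (x, y)" using *(1) L by simp
  have "?J (x, y) \<le> exp (L * norm y)" using *(2) L by simp
  also have "\<dots> \<le> exp (L * \<delta>)"
    using z L by (auto simp: U0_def intro: order_trans[of _ "norm y * 2"])
  finally show "?J (x, y) \<le> exp (L * \<delta>)" .
qed

text \<open>The definition of \<open>fol_H\<close> involves the inverse of \<open>fol_map\<close>,
  so regularity is read off instead from \<open>H = (1/J) \<partial>\<^sub>y J\<close>: as
  \<open>J\<close> has no zeros and is of class C^(r-1), one order is lost.\<close>

lemma Ck_on_fol_H:
  fixes \<kappa> :: "'m::topological_space \<Rightarrow> ('m, 'u::finite, 's::finite) chart"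
  assumes W: "W \<in> W_class \<A> r K \<delta> \<kappa> L" and r: "2 \<le> r" and L: "0 < L"
    and A: "is_atlas r \<A>" "chart_choice \<A> \<delta>' \<kappa>"
  shows "Ck_on (r - 2) (fol_H \<delta> \<kappa> W \<xi>) (U0 \<delta>)"
proof -
  let ?J = "fol_J \<delta> \<kappa> W \<xi>" and ?H = "fol_H \<delta> \<kappa> W \<xi> :: ('u, 's) model \<Rightarrow> real ^ 's"
  have W': "W \<in> regular_cone_foliations \<A> (Suc (Suc (r - 2))) K \<delta> \<kappa>"
    using W_class_imp_regular[OF W] r by (simp add: numeral_2_eq_2 Suc_diff_Suc)
  note J = Ck_on_fol_J[OF W', of \<xi>]
  have pos: "?J z \<noteq> 0" if "z \<in> U0 \<delta>" for z
    using fol_J_pos_bounded(1)[OF W r L A, of "fst z" "snd z" \<xi>] that by simp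
  show ?thesis
  proof (rule Ck_on_cong_open[OF open_U0])
    show "Ck_on (r - 2) (\<lambda>z. inverse (?J z) *\<^sub>R (\<Sum>k\<in>UNIV. dpart (diry k) ?J z *\<^sub>R axis k 1)) (U0 \<delta>)"
      by (intro Ck_on_scaleR Ck_on_sum Ck_on_inverse open_U0 Ck_on_const
          Ck_on_dpart[OF J] Ck_on_pred[OF J] diry_in_Basis pos)
    fix z :: "('u, 's) model" assume z: "z \<in> U0 \<delta>"
    have "(\<Sum>k\<in>UNIV. dpart (diry k) ?J z *\<^sub>R axis k 1) =
        ?J z *\<^sub>R (\<Sum>k\<in>UNIV. ?H z $ k *\<^sub>R axis k 1)"
      by (simp add: dpart_fol_J[OF W_class_imp_regular[OF W] r A z pos[OF z]] scaleR_sum_right)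
    also have "(\<Sum>k\<in>UNIV. ?H z $ k *\<^sub>R axis k 1) = ?H z"
      by (simp add: basis_expansion flip: scalar_mult_eq_scaleR)
    finally show "inverse (?J z) *\<^sub>R (\<Sum>k\<in>UNIV. dpart (diry k) ?J z *\<^sub>R axis k 1) = ?H z"
      using pos[OF z] by simp
  qed
qed

text \<open>The sum dominates each single class bound whether \<open>L\<close> is below or above 1,
  because all its terms are positive.\<close>

lemma mpart_bound_fol_H_slice:
  fixes \<kappa> :: "'m::topological_space \<Rightarrow> ('m, 'u::finite, 's::finite) chart"
  assumes W: "W \<in> W_class \<A> r K \<delta> \<kappa> L" and r: "2 \<le> r" and L: "0 < L"
    and x: "x \<in> ball 0 (\<delta> / 2)"
  shows "mpart_bound (r - 2) (\<Sum>n\<le>r. L ^ ((n + 1)\<^sup>2)) (\<lambda>y. fol_H \<delta> \<kappa> W \<xi> (x, y)) (ball 0 (\<delta> / 2))"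
  unfolding mpart_bound_def
proof (intro allI impI ballI)
  fix \<alpha> and y :: "real ^ 's"
  assume \<alpha>: "length \<alpha> \<le> r - 2 \<and> set \<alpha> \<subseteq> (Basis :: (real ^ 's) set)" and y: "y \<in> ball 0 (\<delta> / 2)"
  \<comment> \<open>Basis vectors are exactly the \<open>axis k 1\<close>, so lists of directions
    translate into the lists of indices used in \<open>W_class\<close>.\<close>
  have "set \<alpha> \<subseteq> range (\<lambda>k. axis k 1)"
    using \<alpha> by (auto simp: Basis_vec_def)
  then have "\<exists>\<beta>. \<alpha> = map (\<lambda>k. axis k 1) \<beta>"
    unfolding ex_map_conv by blast
  then obtain \<beta> where \<beta>: "\<alpha> = map (\<lambda>k. axis k 1) \<beta>" ..
  have "map (Pair 0) \<alpha> = (map diry \<beta> :: ('u, 's) model list)"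
    by (simp add: \<beta> diry_def)
  then have "norm (mpart \<alpha> (\<lambda>y. fol_H \<delta> \<kappa> W \<xi> (x, y)) y) =
      norm (mpart (map diry \<beta>) (fol_H \<delta> \<kappa> W \<xi>) (x, y))"
    by (simp add: mpart_slice)
  also have "\<dots> \<le> L ^ ((length \<beta> + 1)\<^sup>2)"
    using \<alpha> r x y by (intro W_class_fol_H_bound[OF W]) (auto simp: \<beta> U0_def)
  also have "\<dots> \<le> (\<Sum>n\<le>r. L ^ ((n + 1)\<^sup>2))"
    using \<alpha> L r by (intro member_le_sum[of _ _ "\<lambda>n. L ^ ((n + 1)\<^sup>2)"]) (auto simp: \<beta>)
  finally show "norm (mpart \<alpha> (\<lambda>y. fol_H \<delta> \<kappa> W \<xi> (x, y)) y) \<le> (\<Sum>n\<le>r. L ^ ((n + 1)\<^sup>2))" .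
qed

text \<open>\<open>Ck_on\<close> accompanies the norm bound so that the iterated
  \<open>dpart\<close> inside \<open>C_norm\<close> are genuine derivatives, and
  \<open>has_derivative\<close> expresses the differential equation in all y-directions at
  once.\<close>

theorem lemmaB7:
  fixes \<A> :: "('m::t2_space, 'u::finite, 's::finite) chart set"
    and T :: "'m \<Rightarrow> 'm"
    and K :: "'m \<Rightarrow> ('m, 'u, 's) tvec set"
    and \<kappa> :: "'m \<Rightarrow> ('m, 'u, 's) chart"
    and W :: "'m set set"
    and \<delta>\<^sub>0 L :: real
    and r q :: nat
  assumes "2 \<le> r" and "0 < L" and "q \<le> r - 1"
    and "compact (UNIV :: 'm set)" and "is_atlas r \<A>"
    and "anosov_stable_cone \<A> r T K"
    and "0 < \<delta>\<^sub>0" and "chart_choice \<A> \<delta>\<^sub>0 \<kappa>"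
    and "W \<in> W_class \<A> r K \<delta>\<^sub>0 \<kappa> L"
  shows "(\<exists>C>0. \<exists>\<rho>\<^sub>0>0. \<rho>\<^sub>0 \<le> \<delta>\<^sub>0 / 2 \<and>
           (\<forall>\<xi> \<rho>. \<forall>(x' :: real ^ 'u) (y' :: real ^ 's). 0 < \<rho> \<and> \<rho> < \<rho>\<^sub>0 \<and> norm (x', y') \<le> \<rho> \<longrightarrow>
              Ck_on q (\<lambda>y. fol_J \<delta>\<^sub>0 \<kappa> W \<xi> (x', y)) (ball 0 (\<delta>\<^sub>0 / 2)) \<and>
              C_norm q {y. norm (x', y) \<le> \<rho>} (\<lambda>y. fol_J \<delta>\<^sub>0 \<kappa> W \<xi> (x', y)) \<le> ennreal C)) \<and>
         (\<forall>\<xi>. \<forall>(x, y) \<in> U0 \<delta>\<^sub>0.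
           ((\<lambda>y. fol_J \<delta>\<^sub>0 \<kappa> W \<xi> (x, y)) has_derivative
              (\<lambda>v. fol_J \<delta>\<^sub>0 \<kappa> W \<xi> (x, y) * (fol_H \<delta>\<^sub>0 \<kappa> W \<xi> (x, y) \<bullet> v))) (at y) \<and>
           fol_J \<delta>\<^sub>0 \<kappa> W \<xi> (x, 0) = 1)"
proof -
  let ?J = "fol_J \<delta>\<^sub>0 \<kappa> W" and ?H = "fol_H \<delta>\<^sub>0 \<kappa> W"
  define B :: "(real ^ 's) set" where "B = ball 0 (\<delta>\<^sub>0 / 2)"
  \<comment> \<open>The order to which \<open>H\<close> is controlled; the Jacobian is controlled to
    order \<open>m + 1 = r - 1\<close>, which covers \<open>q\<close>.\<close>
  define m where "m = r - 2"
  have r: "r = Suc (Suc m)" using \<open>2 \<le> r\<close> by (simp add: m_def)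
  note W = \<open>W \<in> W_class \<A> r K \<delta>\<^sub>0 \<kappa> L\<close>
  note W' = W_class_imp_regular[OF W]
  note A = \<open>is_atlas r \<A>\<close> \<open>chart_choice \<A> \<delta>\<^sub>0 \<kappa>\<close>
  have CJ: "Ck_on (Suc m) (?J \<xi>) (U0 \<delta>\<^sub>0)" for \<xi>
    by (rule Ck_on_fol_J) (use W' in \<open>simp only: r\<close>)
  have pos: "0 < ?J \<xi> (x, y)" "?J \<xi> (x, y) \<le> exp (L * \<delta>\<^sub>0)" if "(x, y) \<in> U0 \<delta>\<^sub>0" for \<xi> x y
    using fol_J_pos_bounded[OF W \<open>2 \<le> r\<close> \<open>0 < L\<close> A that] by auto
  have dJ: "dpart (0, v) (?J \<xi>) (x, y) = ?J \<xi> (x, y) * (?H \<xi> (x, y) \<bullet> v)"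
    if z: "(x, y) \<in> U0 \<delta>\<^sub>0" for \<xi> x y v
    using dpart_fol_J[OF W' \<open>2 \<le> r\<close> A z] pos(1)[OF z, of \<xi>] Ck_on_imp_differentiable[OF CJ z]
    by (intro dpart_y_eq_sum) auto
  have slice: "dpart b (\<lambda>y. ?J \<xi> (x, y)) y = ?J \<xi> (x, y) * (?H \<xi> (x, y) \<bullet> b)"
    if "(x, y) \<in> U0 \<delta>\<^sub>0" for \<xi> x y b
    using dJ[OF that] by (simp add: dpart_slice)
  define N where "N = (\<Sum>n\<le>r. L ^ ((n + 1)\<^sup>2))"
  have N: "N \<ge> 0" using \<open>0 < L\<close> by (auto simp: N_def intro: sum_nonneg)
  have "open B" by (simp add: B_def)
  have q: "q \<le> Suc m" using \<open>q \<le> r - 1\<close> r by simp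
  \<comment> \<open>The constant is fixed before the point \<open>\<xi>\<close> and the slice
    \<open>x\<close>, which makes the final bound uniform in both.\<close>
  from mpart_bound_log_derivative[OF \<open>open B\<close> exp_ge_zero[of "L * \<delta>\<^sub>0"] N q] obtain C where C: "C \<ge> 0" and bound: "\<And>j h. Ck_on (Suc m) j B \<Longrightarrow> Ck_on m h B \<Longrightarrow>
      (\<forall>p\<in>B. \<bar>j p\<bar> \<le> exp (L * \<delta>\<^sub>0)) \<Longrightarrow> mpart_bound m N h B \<Longrightarrow>
      (\<forall>p\<in>B. \<forall>b\<in>Basis. dpart b j p = j p * (h p \<bullet> b)) \<Longrightarrow> mpart_bound q C j B"
    by blast
  have main: "Ck_on q (\<lambda>y. ?J \<xi> (x, y)) B \<and>
      C_norm q {y. norm (x, y) \<le> \<rho>} (\<lambda>y. ?J \<xi> (x, y)) \<le> ennreal (real (Suc q) * C + 1)"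
    if \<rho>: "\<rho> < \<delta>\<^sub>0 / 2" and xy: "norm (x, y') \<le> \<rho>" for \<xi> \<rho> x and y' :: "real ^ 's"
  proof
    \<comment> \<open>The vector \<open>y'\<close> serves only to bound the norm of \<open>x\<close>
      by \<open>\<rho>\<close>, which places the whole slice inside \<open>U0\<close>.\<close>
    have x: "x \<in> ball 0 (\<delta>\<^sub>0 / 2)" using \<rho> xy norm_fst_le[of x y'] by simp
    have U: "(x, y) \<in> U0 \<delta>\<^sub>0" if "y \<in> B" for y using x that by (auto simp: U0_def B_def)
    have J: "Ck_on (Suc m) (\<lambda>y. ?J \<xi> (x, y)) B"
      using Ck_on_slice[OF CJ[unfolded U0_def] x] by (simp only: B_def)
    then show "Ck_on q (\<lambda>y. ?J \<xi> (x, y)) B"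
      by (rule Ck_on_mono) (rule q)
    have "mpart_bound q C (\<lambda>y. ?J \<xi> (x, y)) B"
    proof (rule bound[OF J])
      show "Ck_on m (\<lambda>y. ?H \<xi> (x, y)) B"
        using Ck_on_slice[OF Ck_on_fol_H[OF W \<open>2 \<le> r\<close> \<open>0 < L\<close> A, unfolded U0_def] x]
        by (simp only: B_def m_def)
      show "\<forall>y\<in>B. \<bar>?J \<xi> (x, y)\<bar> \<le> exp (L * \<delta>\<^sub>0)"
        using pos U by (auto simp: abs_of_pos)
      show "mpart_bound m N (\<lambda>y. ?H \<xi> (x, y)) B"
        using mpart_bound_fol_H_slice[OF W \<open>2 \<le> r\<close> \<open>0 < L\<close> x] by (simp add: B_def N_def m_def)
      show "\<forall>y\<in>B. \<forall>b\<in>Basis. dpart b (\<lambda>y. ?J \<xi> (x, y)) y = ?J \<xi> (x, y) * (?H \<xi> (x, y) \<bullet> b)"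
        using slice U by blast
    qed
    moreover have "{y. norm (x, y) \<le> \<rho>} \<subseteq> B"
      using \<rho> order_trans[OF norm_snd_le[of _ x]] by (fastforce simp: B_def)
    ultimately have "C_norm q {y. norm (x, y) \<le> \<rho>} (\<lambda>y. ?J \<xi> (x, y)) \<le> ennreal (real (Suc q) * C)"
      using C by (rule C_norm_le)
    \<comment> \<open>Adding 1 makes the constant strictly positive even when
      \<open>C = 0\<close>.\<close>
    also have "\<dots> \<le> ennreal (real (Suc q) * C + 1)" by (rule ennreal_leI) simp
    finally show "C_norm q {y. norm (x, y) \<le> \<rho>} (\<lambda>y. ?J \<xi> (x, y)) \<le> \<dots>" .
  qed
  have "((\<lambda>y. ?J \<xi> (x, y)) has_derivative (\<lambda>v. ?J \<xi> (x, y) * (?H \<xi> (x, y) \<bullet> v))) (at y) \<and>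
      ?J \<xi> (x, 0) = 1" if z: "(x, y) \<in> U0 \<delta>\<^sub>0" for \<xi> x y
  proof
    show "((\<lambda>y. ?J \<xi> (x, y)) has_derivative (\<lambda>v. ?J \<xi> (x, y) * (?H \<xi> (x, y) \<bullet> v))) (at y)"
      using has_derivative_dpart[OF differentiable_slice[OF Ck_on_imp_differentiable[OF CJ z]]]
      by (simp add: slice[OF z])
    show "?J \<xi> (x, 0) = 1"
      using W' z \<open>0 < \<delta>\<^sub>0\<close> by (intro fol_J_0) (auto simp: regular_cone_foliations_def U0_def)
  qed
  moreover have "0 < real (Suc q) * C + 1" using C by (intro add_nonneg_pos mult_nonneg_nonneg) auto
  ultimately show ?thesis
    using main \<open>0 < \<delta>\<^sub>0\<close> unfolding B_def
    by (intro conjI exI[of _ "real (Suc q) * C + 1"] exI[of _ "\<delta>\<^sub>0 / 2"]) auto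
qed

end
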